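(* Let $\Omega\subset\mathbb{H}$ be a slice domain and let $f,g\in\mathcal{SEM}(\Omega)$. The following conditions are equivalent: (1) $f\simeq g$; (2) $f_0=g_0$ and $f^s=g^s$; (3) the operator $\mathcal{S}_{f,-g}:\mathcal{SEM}(\Omega)\to\mathcal{SEM}(\Omega)$, $\mathcal{S}_{f,-g}(\chi)=f*\chi-\chi*g$, is not an isomorphism.
   Context: $\mathbb{H}$ denotes the quaternions, $q^c$ the quaternionic conjugate, $\mathbb{S}=\{q\in\mathbb{H}: q^2=-1\}$, and $\mathbb{C}_I=\mathbb{R}+I\mathbb{R}$ for $I\in\mathbb{S}$. For $q=x+Iy$ put $\mathbb{S}_q=\{x+Jy: J\in\mathbb{S}\}$. A domain (connected open set) $\Omega\subset\mathbb{H}$ is circular if $\mathbb{S}_q\subset\Omega$ for all $q\in\Omega$; a circular domain is a slice domain if $\Omega\cap\mathbb{R}\neq\emptyset$ and a product domain otherwise. A function $f$ on a circular open set $\Omega$ is slice regular ($f\in\mathcal{SR}(\Omega)$) if $f(x+Iy)=F_1(x,y)+IF_2(x,y)$ for all $x+Iy\in\Omega$ ($x,y\in\mathbb{R}$, $I\in\mathbb{S}$), with $\mathbb{H}$-valued $F_1$ even in $y$ and $F_2$ odd in $y$, and each restriction $f|_{\Omega\cap\mathbb{C}_I}$ is real differentiable with $\frac12(\partial_x+I\partial_y)f|_{\Omega\cap\mathbb{C}_I}\equiv0$. The $*$-product is $(f*g)(q)=0$ if $f(q)=0$ and $(f*g)(q)=f(q)\,g(f(q)^{-1}qf(q))$ otherwise.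 $f$ is slice preserving if $f(\Omega\cap\mathbb{C}_I)\subset\mathbb{C}_I$ for every $I\in\mathbb{S}$. A function $f$ is slice semi-regular on $\Omega$ ($f\in\mathcal{SEM}(\Omega)$) if there is a circular open $\widetilde\Omega\subseteq\Omega$ with $f\in\mathcal{SR}(\widetilde\Omega)$ and each point of $\Omega\setminus\widetilde\Omega$ is a pole or a removable singularity; i.e. $\Omega\setminus\widetilde\Omega$ consists of isolated real points and isolated spheres $\mathbb{S}_p$, near each of which $\Delta_p^m f$ extends slice regularly for some integer $m\ge0$, where $\Delta_p(q)=q^2-2\mathrm{Re}(p)q+|p|^2$. Functions agreeing where both are defined are identified. $\mathcal{SEM}_{\mathbb{R}}(\Omega)$ is the subset of slice preserving elements; it is a field and the center of the algebra $(\mathcal{SEM}(\Omega),+,* )$, which is a 4-dimensional vector space over it: for an orthonormal basis $(1,I,J,K)$ of $\mathbb{H}$, each $f$ is uniquely $f_0+f_1I+f_2J+f_3K$ with $f_\ell\in\mathcal{SEM}_{\mathbb{R}}(\Omega)$. Set $f^c=f_0-(f_1I+f_2J+f_3K)$, $f^s=f*f^c=f_0^2+f_1^2+f_2^2+f_3^2$, $f_0=(f+f^c)/2$. $f$ is $*$-invertible iff $f^s\not\equiv0$, with $f^{-*}=(f^s)^{-1}f^c$. We write $f\simeq g$ if there is a $*$-invertible $h\in\mathcal{SEM}(\Omega)$ with $f=h^{-*}*g*h$. Isomorphism means isomorphism of $\mathcal{SEM}_{\mathbb{R}}(\Omega)$-vector spaces. *)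

theory Defs
  imports "HOL-Analysis.Analysis" "HOL-Algebra.Ring"
begin

section \<open>Quaternions\<close>

datatype quat = Quat (qre: real) (qi: real) (qj: real) (qk: real)

lemma quat_eq_iff: "a = b \<longleftrightarrow> qre a = qre b \<and> qi a = qi b \<and> qj a = qj b \<and> qk a = qk b"
  by (cases a; cases b) simp

instantiation quat :: real_vector
begin

definition "0 = Quat 0 0 0 0"
definition "a + b = Quat (qre a + qre b) (qi a + qi b) (qj a + qj b) (qk a + qk b)"
definition "- a = Quat (- qre a) (- qi a) (- qj a) (- qk a)"
definition "a - b = Quat (qre a - qre b) (qi a - qi b) (qj a - qj b) (qk a - qk b)"
definition "r *\<^sub>R a = Quat (r * qre a) (r * qi a) (r * qj a) (r * qk a)"

instance
  by standard
    (simp_all add: quat_eq_iff zero_quat_def plus_quat_def uminus_quat_def minus_quat_def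
      scaleR_quat_def algebra_simps)

end

instantiation quat :: real_inner
begin

definition "inner a b = qre a * qre b + qi a * qi b + qj a * qj b + qk a * qk b"
  for a b :: quat
definition "norm a = sqrt (inner a a)" for a :: quat
definition "sgn a = a /\<^sub>R norm a" for a :: quat
definition "dist a b = norm (a - b)" for a b :: quat
definition [code del]:
  "(uniformity :: (quat \<times> quat) filter) = (INF e\<in>{0<..}. principal {(a, b). dist a b < e})"
definition [code del]:
  "open U \<longleftrightarrow> (\<forall>a\<in>U. eventually (\<lambda>(a', b). a' = a \<longrightarrow> b \<in> U) uniformity)"
  for U :: "quat set"

instance
proof
  fix a b c :: quat and r :: real
  show "inner a b = inner b a" "inner (a + b) c = inner a c + inner b c"
    "inner (r *\<^sub>R a) b = r * inner a b"
    by (simp_all add: inner_quat_def plus_quat_def scaleR_quat_def algebra_simps)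
  show "0 \<le> inner a a" by (simp add: inner_quat_def)
  show "inner a a = 0 \<longleftrightarrow> a = 0"
    by (auto simp: inner_quat_def quat_eq_iff zero_quat_def add_nonneg_eq_0_iff)
qed (rule norm_quat_def sgn_quat_def dist_quat_def uniformity_quat_def open_quat_def)+

end

instantiation quat :: real_normed_div_algebra
begin

definition "1 = Quat 1 0 0 0"
definition "a * b = Quat
  (qre a * qre b - qi a * qi b - qj a * qj b - qk a * qk b)
  (qre a * qi b + qi a * qre b + qj a * qk b - qk a * qj b)
  (qre a * qj b - qi a * qk b + qj a * qre b + qk a * qi b)
  (qre a * qk b + qi a * qj b - qj a * qi b + qk a * qre b)"
definition "inverse a = Quat (qre a) (- qi a) (- qj a) (- qk a) /\<^sub>R (norm a)\<^sup>2" for a :: quat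
definition "a div b = a * inverse b" for a b :: quat

instance
proof
  fix a b c :: quat and r :: real
  have norm2: "(norm a)\<^sup>2 = (qre a)\<^sup>2 + (qi a)\<^sup>2 + (qj a)\<^sup>2 + (qk a)\<^sup>2" for a :: quat
    by (simp add: norm_quat_def inner_quat_def power2_eq_square)
  show "a * b * c = a * (b * c)" "(a + b) * c = a * c + b * c" "a * (b + c) = a * b + a * c"
    "1 * a = a" "a * 1 = a" "(0 :: quat) \<noteq> 1"
    "r *\<^sub>R a * b = r *\<^sub>R (a * b)" "a * r *\<^sub>R b = r *\<^sub>R (a * b)"
    by (simp_all add: quat_eq_iff times_quat_def plus_quat_def one_quat_def zero_quat_def
        scaleR_quat_def algebra_simps)
  show "norm (a * b) = norm a * norm b"
    unfolding norm_quat_def real_sqrt_mult [symmetric]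
    by (rule arg_cong [where f = sqrt])
      (simp add: inner_quat_def times_quat_def algebra_simps)
  show "inverse (0 :: quat) = 0"
    by (simp add: inverse_quat_def)
  show "a div b = a * inverse b" by (rule divide_quat_def)
  assume "a \<noteq> 0"
  hence nz: "(norm a)\<^sup>2 \<noteq> 0" by simp
  have c: "Quat (qre a) (- qi a) (- qj a) (- qk a) * a = Quat ((norm a)\<^sup>2) 0 0 0"
    "a * Quat (qre a) (- qi a) (- qj a) (- qk a) = Quat ((norm a)\<^sup>2) 0 0 0"
    by (simp_all add: times_quat_def norm2 flip: power2_eq_square)
  have s: "r *\<^sub>R u * v = r *\<^sub>R (u * v)" "u * r *\<^sub>R v = r *\<^sub>R (u * v)" for u v :: quat and r
    by (simp_all add: quat_eq_iff times_quat_def scaleR_quat_def algebra_simps)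
  show "inverse a * a = 1" "a * inverse a = 1"
    unfolding inverse_quat_def s c using nz by (simp_all add: scaleR_quat_def one_quat_def)
qed

end


section \<open>Slice regular functions\<close>

definition imag_units :: "quat set" (\<open>\<S>\<close>) where
  "\<S> = {q. q\<^sup>2 = - 1}"

definition cplane :: "quat \<Rightarrow> quat set" where
  "cplane I = {of_real x + I * of_real y | x y. True}"

definition qsphere :: "quat \<Rightarrow> quat set" where
  "qsphere q = {of_real x + J * of_real y | x y I J.
     I \<in> \<S> \<and> J \<in> \<S> \<and> q = of_real x + I * of_real y}"

definition circular :: "quat set \<Rightarrow> bool" where
  "circular \<Omega> \<longleftrightarrow> (\<forall>q\<in>\<Omega>. qsphere q \<subseteq> \<Omega>)"

definition slice_domain :: "quat set \<Rightarrow> bool" where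
  "slice_domain \<Omega> \<longleftrightarrow> open \<Omega> \<and> connected \<Omega> \<and> circular \<Omega> \<and> \<Omega> \<inter> \<real> \<noteq> {}"

definition slice_function :: "quat set \<Rightarrow> (quat \<Rightarrow> quat) \<Rightarrow> bool" where
  "slice_function \<Omega> f \<longleftrightarrow> (\<exists>F\<^sub>1 F\<^sub>2 :: real \<Rightarrow> real \<Rightarrow> quat.
     (\<forall>x y. F\<^sub>1 x (- y) = F\<^sub>1 x y) \<and> (\<forall>x y. F\<^sub>2 x (- y) = - F\<^sub>2 x y) \<and>
     (\<forall>x y. \<forall>I\<in>\<S>. of_real x + I * of_real y \<in> \<Omega> \<longrightarrow>
        f (of_real x + I * of_real y) = F\<^sub>1 x y + I * F\<^sub>2 x y))"

text \<open>Below, \<open>D (1, 0)\<close> and \<open>D (0, 1)\<close> are the partial derivatives in \<open>x\<close> and in \<open>y\<close>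
  of the restriction of \<open>f\<close> to \<open>\<Omega> \<inter> cplane I\<close>, in the coordinates \<open>x + I y\<close>.\<close>

definition slice_regular :: "quat set \<Rightarrow> (quat \<Rightarrow> quat) \<Rightarrow> bool" where
  "slice_regular \<Omega> f \<longleftrightarrow> slice_function \<Omega> f \<and>
     (\<forall>I\<in>\<S>. \<forall>x y. of_real x + I * of_real y \<in> \<Omega> \<longrightarrow>
        (\<exists>D. ((\<lambda>(s, t). f (of_real s + I * of_real t)) has_derivative D) (at (x, y)) \<and>
             (1 / 2) *\<^sub>R (D (1, 0) + I * D (0, 1)) = 0))"

definition star_prod :: "(quat \<Rightarrow> quat) \<Rightarrow> (quat \<Rightarrow> quat) \<Rightarrow> quat \<Rightarrow> quat" where
  "star_prod f g q = (if f q = 0 then 0 else f q * g (inverse (f q) * q * f q))"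

definition \<Delta> :: "quat \<Rightarrow> quat \<Rightarrow> quat" where
  "\<Delta> p q = q\<^sup>2 - of_real (2 * qre p) * q + of_real ((norm p)\<^sup>2)"


section \<open>Slice semi-regular functions\<close>

text \<open>A semi-regular function on \<open>\<Omega>\<close> is given by a partial function, whose domain \<open>dom f\<close>
  is the open set (written with a tilde in the literature) on which it is slice regular.
  As \<open>\<Delta> p\<close> is slice preserving, its powers can be multiplied pointwise.\<close>

definition semi_regular :: "quat set \<Rightarrow> (quat \<rightharpoonup> quat) \<Rightarrow> bool" where
  "semi_regular \<Omega> f \<longleftrightarrow>
     dom f \<subseteq> \<Omega> \<and> open (dom f) \<and> circular (dom f) \<and> slice_regular (dom f) (the \<circ> f) \<and>
     (\<forall>p\<in>\<Omega> - dom f. \<exists>U m g. open U \<and> circular U \<and> p \<in> U \<and> U \<subseteq> \<Omega> \<and> U - qsphere p \<subseteq> dom f \<and>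
        slice_regular U g \<and> (\<forall>q\<in>U - qsphere p. g q = \<Delta> p q ^ m * the (f q)))"

definition slice_preserving :: "(quat \<rightharpoonup> quat) \<Rightarrow> bool" where
  "slice_preserving f \<longleftrightarrow> (\<forall>I\<in>\<S>. (the \<circ> f) ` (dom f \<inter> cplane I) \<subseteq> cplane I)"

text \<open>Partial functions agreeing where both are defined are identified; the elements of the
  algebra of semi-regular functions are the resulting equivalence classes.\<close>

definition sem_rel :: "quat set \<Rightarrow> ((quat \<rightharpoonup> quat) \<times> (quat \<rightharpoonup> quat)) set" where
  "sem_rel \<Omega> = {(f, g). semi_regular \<Omega> f \<and> semi_regular \<Omega> g \<and>
     (\<forall>q\<in>dom f \<inter> dom g. f q = g q)}"

type_synonym sem = "(quat \<rightharpoonup> quat) set"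

definition sem_const :: "quat set \<Rightarrow> quat \<Rightarrow> sem" where
  "sem_const \<Omega> c = sem_rel \<Omega> `` {(\<lambda>_. Some c) |` \<Omega>}"

definition pplus :: "(quat \<rightharpoonup> quat) \<Rightarrow> (quat \<rightharpoonup> quat) \<Rightarrow> (quat \<rightharpoonup> quat)" where
  "pplus f g = (\<lambda>q. Some (the (f q) + the (g q))) |` (dom f \<inter> dom g)"

definition pstar :: "(quat \<rightharpoonup> quat) \<Rightarrow> (quat \<rightharpoonup> quat) \<Rightarrow> (quat \<rightharpoonup> quat)" where
  "pstar f g = (\<lambda>q. Some (star_prod (the \<circ> f) (the \<circ> g) q)) |` (dom f \<inter> dom g)"

definition SEM :: "quat set \<Rightarrow> sem ring" where
  "SEM \<Omega> = \<lparr>carrier = Collect (semi_regular \<Omega>) // sem_rel \<Omega>,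
     mult = (\<lambda>X Y. \<Union>f\<in>X. \<Union>g\<in>Y. sem_rel \<Omega> `` {pstar f g}),
     one = sem_const \<Omega> 1,
     zero = sem_const \<Omega> 0,
     add = (\<lambda>X Y. \<Union>f\<in>X. \<Union>g\<in>Y. sem_rel \<Omega> `` {pplus f g})\<rparr>"

definition SEM\<^sub>R :: "quat set \<Rightarrow> sem set" where
  "SEM\<^sub>R \<Omega> = {sem_rel \<Omega> `` {f} | f. semi_regular \<Omega> f \<and> slice_preserving f}"


subsection \<open>Components with respect to an orthonormal basis\<close>

definition orthonormal_basis :: "quat \<Rightarrow> quat \<Rightarrow> quat \<Rightarrow> bool" where
  "orthonormal_basis I J K \<longleftrightarrow> norm I = 1 \<and> norm J = 1 \<and> norm K = 1 \<and>
     inner 1 I = 0 \<and> inner 1 J = 0 \<and> inner 1 K = 0 \<and>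
     inner I J = 0 \<and> inner I K = 0 \<and> inner J K = 0"

text \<open>A triple \<open>B = (I, J, K)\<close> stands for the orthonormal basis \<open>(1, I, J, K)\<close>; every
  decomposition \<open>f = f\<^sub>0 + f\<^sub>1 I + f\<^sub>2 J + f\<^sub>3 K\<close> below has slice preserving \<open>f\<^sub>0, \<dots>, f\<^sub>3\<close>.\<close>

definition vec_part :: "quat set \<Rightarrow> quat \<times> quat \<times> quat \<Rightarrow> sem \<Rightarrow> sem \<Rightarrow> sem \<Rightarrow> sem" where
  "vec_part \<Omega> = (\<lambda>(I, J, K) f\<^sub>1 f\<^sub>2 f\<^sub>3.
     f\<^sub>1 \<otimes>\<^bsub>SEM \<Omega>\<^esub> sem_const \<Omega> I \<oplus>\<^bsub>SEM \<Omega>\<^esub>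
     f\<^sub>2 \<otimes>\<^bsub>SEM \<Omega>\<^esub> sem_const \<Omega> J \<oplus>\<^bsub>SEM \<Omega>\<^esub>
     f\<^sub>3 \<otimes>\<^bsub>SEM \<Omega>\<^esub> sem_const \<Omega> K)"

definition components ::
  "quat set \<Rightarrow> quat \<times> quat \<times> quat \<Rightarrow> sem \<Rightarrow> sem \<Rightarrow> sem \<Rightarrow> sem \<Rightarrow> sem \<Rightarrow> bool" where
  "components \<Omega> B f f\<^sub>0 f\<^sub>1 f\<^sub>2 f\<^sub>3 \<longleftrightarrow>
     {f\<^sub>0, f\<^sub>1, f\<^sub>2, f\<^sub>3} \<subseteq> SEM\<^sub>R \<Omega> \<and> f = f\<^sub>0 \<oplus>\<^bsub>SEM \<Omega>\<^esub> vec_part \<Omega> B f\<^sub>1 f\<^sub>2 f\<^sub>3"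

definition real_part :: "quat set \<Rightarrow> quat \<times> quat \<times> quat \<Rightarrow> sem \<Rightarrow> sem" where
  "real_part \<Omega> B f = (THE f\<^sub>0. \<exists>f\<^sub>1 f\<^sub>2 f\<^sub>3. components \<Omega> B f f\<^sub>0 f\<^sub>1 f\<^sub>2 f\<^sub>3)"

definition conjugate :: "quat set \<Rightarrow> quat \<times> quat \<times> quat \<Rightarrow> sem \<Rightarrow> sem" where
  "conjugate \<Omega> B f = (THE g. \<exists>f\<^sub>0 f\<^sub>1 f\<^sub>2 f\<^sub>3. components \<Omega> B f f\<^sub>0 f\<^sub>1 f\<^sub>2 f\<^sub>3 \<and>
     g = f\<^sub>0 \<ominus>\<^bsub>SEM \<Omega>\<^esub> vec_part \<Omega> B f\<^sub>1 f\<^sub>2 f\<^sub>3)"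

definition symmetrization :: "quat set \<Rightarrow> quat \<times> quat \<times> quat \<Rightarrow> sem \<Rightarrow> sem" where
  "symmetrization \<Omega> B f = f \<otimes>\<^bsub>SEM \<Omega>\<^esub> conjugate \<Omega> B f"


subsection \<open>Similarity and the Sylvester operator\<close>

text \<open>\<open>Units\<close> and \<open>inv\<close> refer to two-sided inverses for the \<open>*\<close>-product, the
  multiplication of \<open>SEM \<Omega>\<close>.\<close>

definition similar :: "quat set \<Rightarrow> sem \<Rightarrow> sem \<Rightarrow> bool" where
  "similar \<Omega> f g \<longleftrightarrow>
     (\<exists>h\<in>Units (SEM \<Omega>). f = inv\<^bsub>SEM \<Omega>\<^esub> h \<otimes>\<^bsub>SEM \<Omega>\<^esub> g \<otimes>\<^bsub>SEM \<Omega>\<^esub> h)"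

definition sylvester_minus :: "quat set \<Rightarrow> sem \<Rightarrow> sem \<Rightarrow> sem \<Rightarrow> sem" where
  "sylvester_minus \<Omega> f g X = f \<otimes>\<^bsub>SEM \<Omega>\<^esub> X \<ominus>\<^bsub>SEM \<Omega>\<^esub> X \<otimes>\<^bsub>SEM \<Omega>\<^esub> g"

definition sem_isomorphism :: "quat set \<Rightarrow> (sem \<Rightarrow> sem) \<Rightarrow> bool" where
  "sem_isomorphism \<Omega> T \<longleftrightarrow>
     T \<in> iso (add_monoid (SEM \<Omega>)) (add_monoid (SEM \<Omega>)) \<and>
     (\<forall>a\<in>SEM\<^sub>R \<Omega>. \<forall>X\<in>carrier (SEM \<Omega>).
        T (a \<otimes>\<^bsub>SEM \<Omega>\<^esub> X) = a \<otimes>\<^bsub>SEM \<Omega>\<^esub> T X)"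

end

theory Submission
  imports Defs "HOL-Complex_Analysis.Meromorphic"
begin

text \<open>Write a slice function as \<open>f (x + I y) = F\<^sub>1 x y + I F\<^sub>2 x y\<close> and expand \<open>F\<^sub>1\<close>, \<open>F\<^sub>2\<close> in the
  standard basis \<open>1, i, j, k\<close>.  This turns \<open>f\<close> into four complex functions \<open>\<Phi>\<close> on the planar shadow
  \<open>D\<close> of \<open>\<Omega>\<close>, with \<open>\<Phi> (cnj z) = cnj (\<Phi> z)\<close>.  Slice regularity of \<open>f\<close> means that they are
  holomorphic, semi-regularity that they are meromorphic on \<open>D\<close> (\<open>semi_regular_imp_stem\<close>,
  \<open>stem_imp_semi_regular\<close>), and the star product becomes the product of quaternions with complex
  coefficients (\<open>star_prod_slice_value\<close>).  So the semi-regular functions form a quaternion algebra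
  over a field of meromorphic functions.

  A slice domain contains a real point \<open>r\<close>, and \<open>D\<close> is connected.  By the identity theorem an
  element of the algebra is determined by its values at the real points near \<open>r\<close>
  (\<open>agree_iff_real_germ\<close>).  At real points the star product is the pointwise product, the
  coefficients \<open>\<Phi>\<close> are real, and \<open>f\<^sub>0\<close> and \<open>f\<^sup>s\<close> are the real part and the squared norm of the
  value.  Every algebraic identity can thus be checked pointwise in the quaternions.  Moreover, a sum
  of squares of real numbers vanishes only if all of them do, so that every nonzero element is a unit
  (\<open>nonzero_unit\<close>).

  For quaternions \<open>a\<close>, \<open>b\<close> let \<open>\<rho>\<close> be the value at \<open>a\<close> of the real quadratic polynomial that
  annihilates \<open>b\<close>.  It vanishes iff \<open>a\<close> and \<open>b\<close> have the same real part and norm, and left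
  multiplication by \<open>\<rho>\<close> is the composition, in either order, of \<open>S c = a c - c b\<close> with a cofactor
  \<open>T\<close> (\<open>sylvester_factor\<close>).  If \<open>\<rho>\<close> is not the zero function, it is a unit, and the Sylvester
  operator is bijective (\<open>sylvester_isomorphism\<close>).  If it is, the values of \<open>T\<close> lie in the kernel of
  the Sylvester operator, and \<open>T = 0\<close> only if \<open>f = g\<close>, when \<open>1\<close> lies in the kernel.  A nonzero element
  of the kernel is a unit that intertwines \<open>f\<close> and \<open>g\<close> (\<open>sylvester_kernel\<close>).\<close>


section \<open>Complex slices of the quaternions\<close>

lemma quat_sel_zero [simp]: "qre 0 = 0" "qi 0 = 0" "qj 0 = 0" "qk 0 = 0"
  by (simp_all add: zero_quat_def)

lemma quat_sel_one [simp]: "qre 1 = 1" "qi 1 = 0" "qj 1 = 0" "qk 1 = 0"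
  by (simp_all add: one_quat_def)

lemma quat_sel_add [simp]:
  "qre (a + b) = qre a + qre b" "qi (a + b) = qi a + qi b"
  "qj (a + b) = qj a + qj b" "qk (a + b) = qk a + qk b"
  by (simp_all add: plus_quat_def)

lemma quat_sel_diff [simp]:
  "qre (a - b) = qre a - qre b" "qi (a - b) = qi a - qi b"
  "qj (a - b) = qj a - qj b" "qk (a - b) = qk a - qk b"
  by (simp_all add: minus_quat_def)

lemma quat_sel_uminus [simp]:
  "qre (- a) = - qre a" "qi (- a) = - qi a" "qj (- a) = - qj a" "qk (- a) = - qk a"
  by (simp_all add: uminus_quat_def)

lemma quat_sel_scaleR [simp]:
  "qre (r *\<^sub>R a) = r * qre a" "qi (r *\<^sub>R a) = r * qi a"
  "qj (r *\<^sub>R a) = r * qj a" "qk (r *\<^sub>R a) = r * qk a"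
  by (simp_all add: scaleR_quat_def)

lemma quat_sel_of_real [simp]:
  "qre (of_real r) = r" "qi (of_real r) = 0" "qj (of_real r) = 0" "qk (of_real r) = 0"
  by (simp_all add: of_real_def)

lemma quat_sel_times:
  "qre (a * b) = qre a * qre b - qi a * qi b - qj a * qj b - qk a * qk b"
  "qi (a * b) = qre a * qi b + qi a * qre b + qj a * qk b - qk a * qj b"
  "qj (a * b) = qre a * qj b - qi a * qk b + qj a * qre b + qk a * qi b"
  "qk (a * b) = qre a * qk b + qi a * qj b - qj a * qi b + qk a * qre b"
  by (simp_all add: times_quat_def)

lemma norm_quat_squared: "(norm (a :: quat))\<^sup>2 = (qre a)\<^sup>2 + (qi a)\<^sup>2 + (qj a)\<^sup>2 + (qk a)\<^sup>2"
  by (simp add: norm_quat_def inner_quat_def power2_eq_square)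

lemma of_real_quat_commute: "of_real r * (q :: quat) = q * of_real r"
  by (simp add: quat_eq_iff quat_sel_times)

lemma imag_units_iff: "I \<in> \<S> \<longleftrightarrow> qre I = 0 \<and> (qi I)\<^sup>2 + (qj I)\<^sup>2 + (qk I)\<^sup>2 = 1"
proof
  assume "I \<in> \<S>"
  hence eq: "qre I * qre I - qi I * qi I - qj I * qj I - qk I * qk I = -1"
    "qre I * qi I = 0" "qre I * qj I = 0" "qre I * qk I = 0"
    by (auto simp: imag_units_def quat_eq_iff power2_eq_square quat_sel_times)
  have "qre I = 0"
  proof (rule ccontr)
    assume "qre I \<noteq> 0"
    with eq have "qre I * qre I = -1" by simp
    thus False using zero_le_square[of "qre I"] by linarith
  qed
  with eq show "qre I = 0 \<and> (qi I)\<^sup>2 + (qj I)\<^sup>2 + (qk I)\<^sup>2 = 1"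
    by (simp add: power2_eq_square)
qed (auto simp: imag_units_def quat_eq_iff power2_eq_square quat_sel_times)

lemma imag_units_square: "I \<in> \<S> \<Longrightarrow> I * I = -1"
  by (simp add: imag_units_def power2_eq_square)

lemma imag_units_uminus: "I \<in> \<S> \<Longrightarrow> - I \<in> \<S>"
  by (simp add: imag_units_def)

text \<open>The reference slice in which shadows and stems are computed.\<close>

definition ref_unit :: quat where "ref_unit = Quat 0 1 0 0"

lemma ref_unit_imag_unit [simp]: "ref_unit \<in> \<S>"
  by (simp add: imag_units_iff ref_unit_def)

text \<open>For an imaginary unit \<open>I\<close> this is the ring isomorphism from the complex numbers onto the
  slice of \<open>I\<close>.\<close>

definition emb :: "quat \<Rightarrow> complex \<Rightarrow> quat" where
  "emb I z = of_real (Re z) + I * of_real (Im z)"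

lemma emb_Complex [simp]: "emb I (Complex x y) = of_real x + I * of_real y"
  by (simp add: emb_def)

lemma emb_of_real [simp]: "emb I (of_real x) = of_real x"
  by (simp add: emb_def)

lemma emb_0 [simp]: "emb I 0 = 0" and emb_1 [simp]: "emb I 1 = 1"
  by (simp_all add: emb_def)

lemma emb_add: "emb I (z + w) = emb I z + emb I w"
  by (simp add: emb_def algebra_simps)

lemma emb_scaleR: "emb I (r *\<^sub>R z) = r *\<^sub>R emb I z"
  by (simp add: quat_eq_iff emb_def quat_sel_times algebra_simps)

lemma emb_diff: "emb I (z - w) = emb I z - emb I w"
  by (simp add: emb_def algebra_simps)

lemma emb_mult:
  assumes "I \<in> \<S>"
  shows "emb I (z * w) = emb I z * emb I w"
proof -
  have *: "qre I = 0" "(qi I)\<^sup>2 = 1 - (qj I)\<^sup>2 - (qk I)\<^sup>2"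
    using assms by (simp_all add: imag_units_iff)
  have "Re z * Re w - ((qi I)\<^sup>2 + (qj I)\<^sup>2 + (qk I)\<^sup>2) * (Im z * Im w) = Re (z * w)"
    using *(2) by simp
  thus ?thesis
    using *(1) by (simp add: quat_eq_iff emb_def quat_sel_times power2_eq_square algebra_simps)
qed

lemma emb_power: "I \<in> \<S> \<Longrightarrow> emb I (z ^ n) = emb I z ^ n"
  by (induction n) (simp_all add: emb_mult)

lemma emb_ii [simp]: "emb I \<i> = I"
  by (simp add: emb_def)

lemma emb_cnj: "emb I (cnj z) = emb (- I) z"
  by (simp add: emb_def)

lemma norm_emb:
  assumes "I \<in> \<S>"
  shows "norm (emb I z) = norm z"
proof -
  have "(norm (emb I z))\<^sup>2 = (Re z)\<^sup>2 + ((qi I)\<^sup>2 * (Im z)\<^sup>2 + (qj I)\<^sup>2 * (Im z)\<^sup>2 + (qk I)\<^sup>2 * (Im z)\<^sup>2)"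
    using assms by (simp add: norm_quat_squared emb_def imag_units_iff quat_sel_times
        power_mult_distrib ring_distribs)
  also have "\<dots> = (Re z)\<^sup>2 + ((qi I)\<^sup>2 + (qj I)\<^sup>2 + (qk I)\<^sup>2) * (Im z)\<^sup>2"
    by (simp only: distrib_right)
  also have "\<dots> = (norm z)\<^sup>2"
    using assms by (simp add: imag_units_iff cmod_def)
  finally show ?thesis by (simp add: power2_eq_iff_nonneg)
qed

lemma bounded_linear_emb: "bounded_linear (emb I)"
proof
  show "\<exists>K. \<forall>x. norm (emb I x) \<le> norm x * K"
  proof (intro exI allI)
    fix x
    have "norm (emb I x) \<le> \<bar>Re x\<bar> + norm I * \<bar>Im x\<bar>"
      unfolding emb_def by (rule norm_triangle_le) (simp add: norm_mult)
    also have "\<dots> \<le> norm x + norm I * norm x"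
      by (intro add_mono mult_left_mono abs_Re_le_cmod abs_Im_le_cmod) auto
    finally show "norm (emb I x) \<le> norm x * (1 + norm I)" by (simp add: algebra_simps)
  qed
qed (simp_all add: emb_add emb_scaleR)

text \<open>Coordinates of a quaternion: a point of the closed upper half-plane, which depends
  continuously on it and determines its sphere, and the unit of a slice through it.  Real
  quaternions lie in all slices and get the reference unit.\<close>

definition height :: "quat \<Rightarrow> complex" where
  "height q = Complex (qre q) (sqrt ((qi q)\<^sup>2 + (qj q)\<^sup>2 + (qk q)\<^sup>2))"

definition axis :: "quat \<Rightarrow> quat" where
  "axis q = (if Im (height q) = 0 then ref_unit else (q - of_real (qre q)) /\<^sub>R Im (height q))"

lemma axis_imag_unit [simp]: "axis q \<in> \<S>"
proof (cases "Im (height q) = 0")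
  case False
  define n where "n = Im (height q)"
  have n: "n \<noteq> 0" "n\<^sup>2 = (qi q)\<^sup>2 + (qj q)\<^sup>2 + (qk q)\<^sup>2"
    using False by (simp_all add: n_def height_def)
  have "(qi q / n)\<^sup>2 + (qj q / n)\<^sup>2 + (qk q / n)\<^sup>2 = 1"
    unfolding power_divide n(2)[symmetric] using n
    by (metis add_divide_distrib divide_self_if power_not_zero)
  thus ?thesis using False
    by (simp add: axis_def imag_units_iff n_def divide_inverse mult.commute)
qed (simp add: axis_def)

lemma emb_axis_height: "emb (axis q) (height q) = q"
proof (cases "Im (height q) = 0")
  case True
  hence "(qi q)\<^sup>2 + (qj q)\<^sup>2 + (qk q)\<^sup>2 = 0" by (simp add: height_def)
  hence "qi q = 0 \<and> qj q = 0 \<and> qk q = 0"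
    by (metis add_nonneg_eq_0_iff zero_le_power2 sum_power2_ge_zero power_zero_numeral zero_eq_power2)
  thus ?thesis by (simp add: emb_def quat_eq_iff height_def quat_sel_times)
next
  case False
  thus ?thesis by (simp add: emb_def axis_def quat_eq_iff quat_sel_times) (simp add: height_def)
qed

lemma height_emb:
  assumes "I \<in> \<S>"
  shows "height (emb I z) = Complex (Re z) \<bar>Im z\<bar>"
proof -
  have "(qi I * Im z)\<^sup>2 + (qj I * Im z)\<^sup>2 + (qk I * Im z)\<^sup>2
      = ((qi I)\<^sup>2 + (qj I)\<^sup>2 + (qk I)\<^sup>2) * (Im z)\<^sup>2"
    by (simp add: algebra_simps)
  also have "\<dots> = (Im z)\<^sup>2" using assms by (simp add: imag_units_iff)
  finally show ?thesis using assms
    by (simp add: height_def emb_def quat_sel_times imag_units_iff)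
qed

lemma height_emb_cases: "I \<in> \<S> \<Longrightarrow> height (emb I z) = z \<or> height (emb I z) = cnj z"
  by (auto simp: height_emb complex_eq_iff)

lemma continuous_height: "continuous_on UNIV height"
proof -
  have sel: "qre = inner 1" "qi = inner (Quat 0 1 0 0)" "qj = inner (Quat 0 0 1 0)"
      "qk = inner (Quat 0 0 0 1)"
    by (auto simp: fun_eq_iff inner_quat_def)
  have eq: "height = (\<lambda>q. of_real (qre q) + \<i> * of_real (sqrt ((qi q)\<^sup>2 + (qj q)\<^sup>2 + (qk q)\<^sup>2)))"
    by (simp add: fun_eq_iff height_def complex_eq_iff)
  show ?thesis unfolding eq sel by (intro continuous_intros)
qed


subsection \<open>Circular sets and their planar shadows\<close>

definition shadow :: "quat set \<Rightarrow> complex set" where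
  "shadow U = emb ref_unit -` U"

text \<open>For \<open>N\<close> symmetric under complex conjugation, the circular set with shadow \<open>N\<close>; as a
  preimage under a continuous map it inherits openness.\<close>

definition sweep :: "complex set \<Rightarrow> quat set" where
  "sweep N = height -` N"

lemma open_shadow: "open U \<Longrightarrow> open (shadow U)"
  unfolding shadow_def
  by (intro open_vimage linear_continuous_on bounded_linear_emb)

lemma open_sweep: "open N \<Longrightarrow> open (sweep N)"
  unfolding sweep_def by (intro open_vimage continuous_height)

lemma qsphere_emb:
  assumes "I \<in> \<S>"
  shows "qsphere (emb I z) = {emb J z | J. J \<in> \<S>}"
proof (intro equalityI subsetI)
  fix q assume "q \<in> qsphere (emb I z)"
  then obtain x y I' J where *: "q = emb J (Complex x y)" "I' \<in> \<S>" "J \<in> \<S>"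
      "emb I z = emb I' (Complex x y)"
    by (auto simp: qsphere_def)
  have "height (emb I z) = height (emb I' (Complex x y))" using *(4) by argo
  hence "Complex x y = z \<or> Complex x y = cnj z"
    unfolding height_emb[OF assms] height_emb[OF *(2)]
    by (auto simp: complex_eq_iff abs_eq_iff)
  hence "q = emb J z \<or> q = emb (- J) z"
    using *(1) emb_cnj by metis
  thus "q \<in> {emb J z | J. J \<in> \<S>}"
    using *(3) imag_units_uminus by blast
next
  fix q assume "q \<in> {emb J z | J. J \<in> \<S>}"
  then obtain J where "J \<in> \<S>" "q = emb J z" by auto
  with assms show "q \<in> qsphere (emb I z)"
    unfolding qsphere_def emb_def by blast
qed

lemma emb_in_circular_iff:
  assumes "circular U" "I \<in> \<S>"
  shows "emb I z \<in> U \<longleftrightarrow> z \<in> shadow U"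
proof -
  have "emb J z \<in> U" if "emb I' z \<in> U" "J \<in> \<S>" "I' \<in> \<S>" for I' J
    using assms(1) that qsphere_emb[of I' z] unfolding circular_def by blast
  from this[of I ref_unit] this[of ref_unit I] assms(2) show ?thesis
    by (auto simp: shadow_def)
qed

lemma shadow_cnj: "circular U \<Longrightarrow> cnj z \<in> shadow U \<longleftrightarrow> z \<in> shadow U"
  using emb_in_circular_iff[of U "- ref_unit" z] imag_units_uminus[OF ref_unit_imag_unit]
  by (simp add: shadow_def emb_cnj)

lemma height_in_shadow: "circular U \<Longrightarrow> height q \<in> shadow U \<longleftrightarrow> q \<in> U"
  using emb_in_circular_iff[of U "axis q" "height q"] by (simp add: emb_axis_height)

lemma emb_in_sweep_iff:
  assumes "\<And>z. cnj z \<in> N \<longleftrightarrow> z \<in> N" "I \<in> \<S>"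
  shows "emb I z \<in> sweep N \<longleftrightarrow> z \<in> N"
  using height_emb_cases[OF assms(2), of z] assms(1)[of z] unfolding sweep_def vimage_eq by metis

lemma circular_sweep: "circular (sweep N)"
  unfolding circular_def
proof (intro ballI subsetI)
  fix q p assume q: "q \<in> sweep N" "p \<in> qsphere q"
  have "p \<in> qsphere (emb (axis q) (height q))" using q by (simp add: emb_axis_height)
  then obtain J where J: "J \<in> \<S>" "p = emb J (height q)" by (auto simp: qsphere_emb)
  have "Im (height q) \<ge> 0" by (simp add: height_def)
  hence "height p = height q" unfolding J(2) height_emb[OF J(1)] by (simp add: complex_eq_iff)
  thus "p \<in> sweep N" using q(1) by (simp add: sweep_def)
qed

lemma shadow_sweep:
  assumes "\<And>z. cnj z \<in> N \<longleftrightarrow> z \<in> N"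
  shows "shadow (sweep N) = N"
proof -
  have "emb ref_unit z \<in> sweep N \<longleftrightarrow> z \<in> N" for z
    by (rule emb_in_sweep_iff) (fact assms, rule ref_unit_imag_unit)
  thus ?thesis unfolding shadow_def vimage_def by simp
qed

text \<open>The upper half of the shadow is the image of the set under \<open>height\<close>, the lower half is its
  mirror image, and both halves contain a real point.\<close>

lemma connected_shadow:
  assumes "circular U" "connected U" "of_real r \<in> U"
  shows "connected (shadow U)"
proof -
  have up: "connected (height ` U)"
    by (rule connected_continuous_image[OF continuous_on_subset[OF continuous_height] assms(2)]) simp
  hence lo: "connected (cnj ` height ` U)"
    by (rule connected_continuous_image[rotated]) (intro continuous_intros)
  have r: "of_real r = height (of_real r)" by (simp add: height_def complex_eq_iff)
  have "of_real r \<in> height ` U" using r assms(3) by (metis imageI)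
  moreover from imageI[OF this, of cnj] have "of_real r \<in> cnj ` height ` U" by simp
  moreover have "shadow U = height ` U \<union> cnj ` height ` U"
  proof (intro equalityI subsetI)
    fix z assume "z \<in> shadow U"
    hence "emb ref_unit z \<in> U" by (simp add: shadow_def)
    moreover have "z = height (emb ref_unit z) \<or> z = cnj (height (emb ref_unit z))"
      using height_emb_cases[OF ref_unit_imag_unit, of z] by (metis complex_cnj_cnj)
    ultimately show "z \<in> height ` U \<union> cnj ` height ` U" by blast
  next
    fix z assume "z \<in> height ` U \<union> cnj ` height ` U"
    thus "z \<in> shadow U"
      using height_in_shadow[OF assms(1)] shadow_cnj[OF assms(1)] by auto
  qed
  ultimately show ?thesis using connected_Un[OF up lo] by auto
qed

lemma \<Delta>_emb:
  assumes "I \<in> \<S>" "J \<in> \<S>"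
  shows "\<Delta> (emb J z) (emb I w) = emb I ((w - z) * (w - cnj z))"
proof -
  have "(w - z) * (w - cnj z) = w * w - of_real (2 * Re z) * w + of_real ((norm z)\<^sup>2)"
    unfolding complex_norm_square complex_add_cnj[symmetric]
    by (simp add: algebra_simps)
  hence "emb I ((w - z) * (w - cnj z))
      = emb I w * emb I w - of_real (2 * Re z) * emb I w + of_real ((norm z)\<^sup>2)"
    by (simp only: emb_add emb_diff emb_mult[OF assms(1)] emb_of_real)
  moreover have "qre (emb J z) = Re z"
    using assms by (simp add: emb_def imag_units_iff quat_sel_times)
  ultimately show ?thesis
    unfolding \<Delta>_def norm_emb[OF assms(2)] power2_eq_square[of "emb I w"] by (simp only:)
qed

section \<open>Slice regular functions as holomorphic stems\<close>

definition std_basis :: "quat set" where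
  "std_basis = {1, Quat 0 1 0 0, Quat 0 0 1 0, Quat 0 0 0 1}"

text \<open>A stem has one complex value for every element of the standard basis of the quaternions, so
  that its values form the complexification of the quaternions.  Replacing the imaginary unit
  of the complex numbers by \<open>I\<close> turns such a value into a quaternion.\<close>

definition slice_value :: "quat \<Rightarrow> (quat \<Rightarrow> complex) \<Rightarrow> quat" where
  "slice_value I w = (\<Sum>e\<in>std_basis. emb I (w e) * e)"

lemma finite_std_basis [simp]: "finite std_basis"
  by (simp add: std_basis_def)

lemma sum_std_basis:
  "(\<Sum>e\<in>std_basis. f e) = f 1 + f (Quat 0 1 0 0) + f (Quat 0 0 1 0) + f (Quat 0 0 0 1)"
  by (simp add: std_basis_def one_quat_def add.assoc)

lemma slice_value_of_real_inner [simp]: "slice_value I (\<lambda>e. of_real (inner e q)) = q"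
  by (simp add: slice_value_def sum_std_basis quat_eq_iff quat_sel_times inner_quat_def)

lemma slice_value_add: "slice_value I (\<lambda>e. v e + w e) = slice_value I v + slice_value I w"
  by (simp add: slice_value_def emb_add distrib_right sum.distrib)

lemma slice_value_mult:
  assumes "I \<in> \<S>"
  shows "slice_value I (\<lambda>e. c * w e) = emb I c * slice_value I w"
  by (simp add: slice_value_def emb_mult[OF assms] sum_distrib_left mult.assoc)

lemma slice_value_cnj: "slice_value I (\<lambda>e. cnj (w e)) = slice_value (- I) w"
  by (simp add: slice_value_def emb_cnj)

lemma slice_value_Complex:
  "slice_value I (\<lambda>e. Complex (inner e a) (inner e b)) = a + I * b"
proof -
  have "Complex (inner e a) (inner e b) = of_real (inner e a) + \<i> * of_real (inner e b)" for e
    by (simp add: complex_eq_iff)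
  moreover have "slice_value I (\<lambda>e. \<i> * of_real (inner e b)) = I * slice_value I (\<lambda>e. of_real (inner e b))"
  proof -
    have "emb I (\<i> * of_real r) = I * of_real r" for r by (simp add: emb_def)
    thus ?thesis unfolding slice_value_def sum_distrib_left by (simp add: mult.assoc)
  qed
  ultimately show ?thesis by (simp add: slice_value_add)
qed

text \<open>The stem of \<open>f\<close> is recovered from the values of \<open>f\<close> in one slice: \<open>even_part\<close> and
  \<open>odd_part\<close> are the functions \<open>F\<^sub>1\<close> and \<open>F\<^sub>2\<close> with \<open>f (x + I y) = F\<^sub>1 x y + I F\<^sub>2 x y\<close>.\<close>

definition even_part :: "(quat \<Rightarrow> quat) \<Rightarrow> complex \<Rightarrow> quat" where
  "even_part f z = (1 / 2) *\<^sub>R (f (emb ref_unit z) + f (emb ref_unit (cnj z)))"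

definition odd_part :: "(quat \<Rightarrow> quat) \<Rightarrow> complex \<Rightarrow> quat" where
  "odd_part f z = (1 / 2) *\<^sub>R (- ref_unit * (f (emb ref_unit z) - f (emb ref_unit (cnj z))))"

definition stem :: "(quat \<Rightarrow> quat) \<Rightarrow> quat \<Rightarrow> complex \<Rightarrow> complex" where
  "stem f e z = Complex (inner e (even_part f z)) (inner e (odd_part f z))"

lemma stem_cnj: "stem f e (cnj z) = cnj (stem f e z)"
proof -
  have "even_part f (cnj z) = even_part f z" by (simp add: even_part_def add.commute)
  moreover have "odd_part f (cnj z) = - odd_part f z"
    unfolding odd_part_def complex_cnj_cnj
    by (simp only: mult_minus_left scaleR_minus_right right_diff_distrib minus_diff_eq scaleR_diff_right)
  ultimately show ?thesis by (simp add: stem_def complex_eq_iff)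
qed

lemma slice_function_stem:
  assumes "slice_function U f" "circular U" "z \<in> shadow U" "I \<in> \<S>"
  shows "f (emb I z) = slice_value I (\<lambda>e. stem f e z)"
proof -
  obtain F G where even: "\<And>x y. F x (- y) = F x y" and odd: "\<And>x y. G x (- y) = - G x y"
    and F: "\<And>x y J. J \<in> \<S> \<Longrightarrow> of_real x + J * of_real y \<in> U \<Longrightarrow>
        f (of_real x + J * of_real y) = F x y + J * G x y"
    using assms(1) unfolding slice_function_def by (metis (no_types))
  have val: "f (emb J w) = F (Re w) (Im w) + J * G (Re w) (Im w)" if "J \<in> \<S>" "w \<in> shadow U" for J w
    using F[of J "Re w" "Im w"] that emb_in_circular_iff[OF assms(2) that(1), of w]
    by (simp add: emb_def)
  have *: "f (emb ref_unit z) = F (Re z) (Im z) + ref_unit * G (Re z) (Im z)"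
    "f (emb ref_unit (cnj z)) = F (Re z) (Im z) - ref_unit * G (Re z) (Im z)"
    using val[OF ref_unit_imag_unit, of z] val[OF ref_unit_imag_unit, of "cnj z"] assms
    by (simp_all add: shadow_cnj even odd)
  have 1: "even_part f z = F (Re z) (Im z)"
    unfolding even_part_def * by (simp add: scaleR_2[symmetric])
  have 2: "odd_part f z = G (Re z) (Im z)"
  proof -
    have "f (emb ref_unit z) - f (emb ref_unit (cnj z)) = 2 *\<^sub>R (ref_unit * G (Re z) (Im z))"
      unfolding * by (simp add: scaleR_2)
    moreover have "- ref_unit * (2 *\<^sub>R (ref_unit * q)) = 2 *\<^sub>R q" for q
      by (simp add: quat_eq_iff quat_sel_times ref_unit_def)
    ultimately show ?thesis unfolding odd_part_def by simp
  qed
  show ?thesis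
    unfolding stem_def 1 2 slice_value_Complex by (rule val[OF assms(4,3)])
qed

text \<open>Slice regularity provides real derivatives only; the Cauchy--Riemann equation makes them
  complex.\<close>

lemma has_field_derivative_cauchy_riemann:
  assumes "(f has_derivative L) (at z)" "L \<i> = \<i> * L 1"
  shows "(f has_field_derivative L 1) (at z)"
proof -
  have lin: "linear L" using assms(1) by (simp add: has_derivative_linear)
  have "L w = L 1 * w" for w
  proof -
    have "L w = L (Re w *\<^sub>R 1 + Im w *\<^sub>R \<i>)"
      by (rule arg_cong[of _ _ L]) (simp add: complex_eq_iff)
    also have "\<dots> = Re w *\<^sub>R L 1 + Im w *\<^sub>R L \<i>"
      using lin by (simp only: linear_add linear_scale)
    also have "\<dots> = L 1 * w"
      unfolding assms(2) by (simp add: complex_eq_iff algebra_simps)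
    finally show ?thesis .
  qed
  hence "L = (*) (L 1)" by (rule ext)
  thus ?thesis using assms(1) by (simp add: has_field_derivative_def)
qed

lemma slice_regular_slice_derivative:
  assumes "slice_regular U f" "I \<in> \<S>" "emb I z \<in> U"
  obtains L where "((\<lambda>w. f (emb I w)) has_derivative L) (at z)" "L \<i> = I * L 1"
proof -
  obtain D where D: "((\<lambda>(s, t). f (of_real s + I * of_real t)) has_derivative D) (at (Re z, Im z))"
    "(1 / 2) *\<^sub>R (D (1, 0) + I * D (0, 1)) = 0"
    using assms unfolding slice_regular_def emb_def by blast
  have "((\<lambda>w. (Re w, Im w)) has_derivative (\<lambda>w. (Re w, Im w))) (at z)"
    by (intro derivative_intros)
  from diff_chain_at[OF this D(1)]
  have "((\<lambda>w. f (emb I w)) has_derivative (\<lambda>w. D (Re w, Im w))) (at z)"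
    by (simp add: o_def emb_def)
  moreover have "D (0, 1) = I * D (1, 0)"
  proof -
    have "D (1, 0) = - (I * D (0, 1))" using D(2) by (simp add: eq_neg_iff_add_eq_0)
    hence "I * D (1, 0) = - (I * I * D (0, 1))" by (simp add: mult.assoc)
    thus ?thesis by (simp add: imag_units_square[OF assms(2)])
  qed
  ultimately show ?thesis using that by auto
qed

text \<open>At \<open>z\<close> and at \<open>cnj z\<close> the derivative of \<open>f\<close> turns multiplication by \<open>\<i>\<close> into multiplication by
  the unit of the slice.  The sum and the difference of both equations are the Cauchy--Riemann equations for the
  even and the odd part.\<close>

lemma holomorphic_on_stem:
  assumes reg: "slice_regular U f" and circ: "circular U" and op: "open U"
  shows "stem f e holomorphic_on shadow U"
proof -
  have "\<exists>d. (stem f e has_field_derivative d) (at z)" if z: "z \<in> shadow U" for z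
  proof -
    let ?i = ref_unit
    have zU: "emb ?i z \<in> U" "emb ?i (cnj z) \<in> U"
      using z shadow_cnj[OF circ, of z] by (auto simp: shadow_def)
    obtain L where L: "((\<lambda>w. f (emb ?i w)) has_derivative L) (at z)" "L \<i> = ?i * L 1"
      using slice_regular_slice_derivative[OF reg ref_unit_imag_unit zU(1)] .
    obtain M where M: "((\<lambda>w. f (emb ?i w)) has_derivative M) (at (cnj z))" "M \<i> = ?i * M 1"
      using slice_regular_slice_derivative[OF reg ref_unit_imag_unit zU(2)] .
    have "(cnj has_derivative cnj) (at z)"
      by (rule bounded_linear_imp_has_derivative[OF bounded_linear_cnj])
    from diff_chain_at[OF this M(1)]
    have M': "((\<lambda>w. f (emb ?i (cnj w))) has_derivative (\<lambda>w. M (cnj w))) (at z)"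
      by (simp add: o_def)
    define A where "A w = (1 / 2) *\<^sub>R (L w + M (cnj w))" for w
    define B where "B w = (1 / 2) *\<^sub>R (- ?i * (L w - M (cnj w)))" for w
    have "(even_part f has_derivative A) (at z)"
      unfolding even_part_def[abs_def] A_def[abs_def] by (intro derivative_intros L(1) M')
    moreover have "(odd_part f has_derivative B) (at z)"
      unfolding odd_part_def[abs_def] B_def[abs_def]
      by (intro has_derivative_scaleR_right has_derivative_mult_right has_derivative_diff L(1) M')
    ultimately have "((\<lambda>w. of_real (inner e (even_part f w)) + \<i> * of_real (inner e (odd_part f w)))
        has_derivative (\<lambda>w. of_real (inner e (A w)) + \<i> * of_real (inner e (B w)))) (at z)"
      by (intro has_derivative_add has_derivative_mult_right has_derivative_of_real
          has_derivative_inner_right)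
    moreover have "(\<lambda>w. of_real (inner e (even_part f w)) + \<i> * of_real (inner e (odd_part f w)))
        = stem f e"
      by (simp add: fun_eq_iff stem_def complex_eq_iff)
    ultimately have der: "(stem f e has_derivative
        (\<lambda>w. of_real (inner e (A w)) + \<i> * of_real (inner e (B w)))) (at z)"
      by simp
    have "M (- \<i>) = - M \<i>"
      using M(1) by (meson has_derivative_linear linear_neg)
    hence i: "A \<i> = (1 / 2) *\<^sub>R (?i * (L 1 - M 1))" "B \<i> = (1 / 2) *\<^sub>R (- ?i * (?i * (L 1 + M 1)))"
      unfolding A_def B_def by (simp_all add: L M algebra_simps)
    have "B \<i> = A 1" "A \<i> = - B 1"
      unfolding i unfolding A_def B_def
      by (simp_all add: imag_units_square flip: mult.assoc)
    thus ?thesis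
      using has_field_derivative_cauchy_riemann[OF der] by (auto simp: algebra_simps)
  qed
  thus ?thesis
    using holomorphic_on_open[OF open_shadow[OF op]] by blast
qed

text \<open>Conversely, the real and the imaginary parts of the stem serve as \<open>F\<^sub>1\<close> and \<open>F\<^sub>2\<close>, and
  multiplicativity of \<open>emb I\<close> turns the complex derivative into the equation for the slice of \<open>I\<close>.\<close>

lemma slice_regular_of_stem:
  assumes holo: "\<And>e. e \<in> std_basis \<Longrightarrow> \<Phi> e holomorphic_on shadow U"
    and sym: "\<And>e z. e \<in> std_basis \<Longrightarrow> z \<in> shadow U \<Longrightarrow> \<Phi> e (cnj z) = cnj (\<Phi> e z)"
    and circ: "circular U" and op: "open U"
    and f: "\<And>I z. I \<in> \<S> \<Longrightarrow> z \<in> shadow U \<Longrightarrow> f (emb I z) = slice_value I (\<lambda>e. \<Phi> e z)"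
  shows "slice_regular U f"
  unfolding slice_regular_def
proof (intro conjI ballI allI impI)
  define F where "F x y = (if Complex x y \<in> shadow U then
      \<Sum>e\<in>std_basis. Re (\<Phi> e (Complex x y)) *\<^sub>R e else 0)" for x y
  define G where "G x y = (if Complex x y \<in> shadow U then
      \<Sum>e\<in>std_basis. Im (\<Phi> e (Complex x y)) *\<^sub>R e else 0)" for x y
  have "F x (- y) = F x y" "G x (- y) = - G x y" for x y
    using shadow_cnj[OF circ, of "Complex x y"] sym[of _ "Complex x y"]
    unfolding complex_cnj by (auto simp: F_def G_def sum_negf[symmetric])
  moreover have "f (of_real x + I * of_real y) = F x y + I * G x y"
    if "I \<in> \<S>" "of_real x + I * of_real y \<in> U" for x y I
  proof -
    have z: "Complex x y \<in> shadow U"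
      using emb_in_circular_iff[OF circ that(1), of "Complex x y"] that by simp
    have "emb I w * e = Re w *\<^sub>R e + I * (Im w *\<^sub>R e)" for w e
      by (simp add: emb_def distrib_right scaleR_conv_of_real mult.assoc)
    hence "slice_value I (\<lambda>e. \<Phi> e (Complex x y)) = F x y + I * G x y"
      using z by (simp add: slice_value_def F_def G_def sum.distrib sum_distrib_left)
    thus ?thesis using f[OF that(1) z] by simp
  qed
  ultimately show "slice_function U f" unfolding slice_function_def by metis
next
  fix I x y
  assume I: "I \<in> \<S>" and "of_real x + I * of_real y \<in> U"
  hence z: "Complex x y \<in> shadow U"
    using emb_in_circular_iff[OF circ I, of "Complex x y"] by simp
  define d where "d e = deriv (\<Phi> e) (Complex x y)" for e
  have der: "(\<Phi> e has_derivative (*) (d e)) (at (Complex x y))" if "e \<in> std_basis" for e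
    using holomorphic_derivI[OF holo[OF that] open_shadow[OF op] z]
    by (simp add: has_field_derivative_def d_def)
  have bl: "bounded_linear (\<lambda>w. emb I w * e)" for e
    using bounded_linear_emb bounded_linear_mult_const by blast
  have "((\<lambda>w. slice_value I (\<lambda>e. \<Phi> e w)) has_derivative (\<lambda>w. slice_value I (\<lambda>e. d e * w)))
      (at (Complex x y))"
    unfolding slice_value_def
    by (intro has_derivative_sum bounded_linear.has_derivative[OF bl] der)
  hence D: "((\<lambda>w. f (emb I w)) has_derivative (\<lambda>w. slice_value I (\<lambda>e. d e * w)))
      (at (Complex x y))"
    by (rule has_derivative_transform_within_open[OF _ open_shadow[OF op] z]) (simp add: f I)
  have C: "((\<lambda>p. of_real (fst p) + \<i> * of_real (snd p)) has_derivative
      (\<lambda>p. of_real (fst p) + \<i> * of_real (snd p))) (at (x, y))"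
    by (intro derivative_eq_intros) auto
  have "Complex x y = (\<lambda>p. of_real (fst p) + \<i> * of_real (snd p)) (x, y)"
    by (simp add: complex_eq_iff)
  from diff_chain_at[OF C D[unfolded this]]
  have E: "((\<lambda>(s, t). f (of_real s + I * of_real t)) has_derivative
      (\<lambda>p. slice_value I (\<lambda>e. d e * (of_real (fst p) + \<i> * of_real (snd p))))) (at (x, y))"
    by (simp add: o_def emb_def case_prod_unfold)
  have "slice_value I (\<lambda>e. d e * \<i>) = I * slice_value I d"
    using slice_value_mult[OF I, of \<i> d] by (simp add: mult.commute)
  moreover have "I * (I * q) = - q" for q
    by (simp add: imag_units_square[OF I] flip: mult.assoc)
  ultimately show "\<exists>D. ((\<lambda>(s, t). f (of_real s + I * of_real t)) has_derivative D) (at (x, y)) \<and>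
      (1 / 2) *\<^sub>R (D (1, 0) + I * D (0, 1)) = 0"
    using E by (intro exI[of _ "\<lambda>p. slice_value I (\<lambda>e. d e * (of_real (fst p) + \<i> * of_real (snd p)))"])
      simp
qed

text \<open>The product of the complexified quaternions in coordinates.\<close>

definition stem_mult :: "(quat \<Rightarrow> complex) \<Rightarrow> (quat \<Rightarrow> complex) \<Rightarrow> quat \<Rightarrow> complex" where
  "stem_mult v w e = (\<Sum>a\<in>std_basis. \<Sum>b\<in>std_basis. of_real (inner e (a * b)) * v a * w b)"

lemma slice_value_sum: "slice_value I (\<lambda>e. \<Sum>a\<in>A. w a e) = (\<Sum>a\<in>A. slice_value I (w a))"
  by (induction A rule: infinite_finite_induct) (simp_all add: slice_value_add, simp_all add: slice_value_def)

lemma slice_value_stem_mult: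
  assumes "I \<in> \<S>"
  shows "slice_value I (stem_mult v w)
    = (\<Sum>a\<in>std_basis. \<Sum>b\<in>std_basis. emb I (v a * w b) * (a * b))"
proof -
  have "slice_value I (\<lambda>e. of_real (inner e (a * b)) * v a * w b) = emb I (v a * w b) * (a * b)" for a b
    using slice_value_mult[OF assms, of "v a * w b" "\<lambda>e. of_real (inner e (a * b))"]
    by (simp add: ac_simps)
  thus ?thesis unfolding stem_mult_def[abs_def] by (simp add: slice_value_sum)
qed

text \<open>With \<open>a = f q\<close> and \<open>q\<close> in the slice of \<open>I\<close>, the conjugate \<open>a\<inverse> q a\<close> lies in the slice of
  \<open>J = a\<inverse> I a\<close>.  Since \<open>a J = I a\<close>, moving \<open>a\<close> past the values of \<open>g\<close> turns \<open>J\<close> back into \<open>I\<close>.\<close>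

lemma star_prod_slice_value:
  assumes "I \<in> \<S>"
    and f: "f (emb I z) = slice_value I v"
    and g: "\<And>J. J \<in> \<S> \<Longrightarrow> g (emb J z) = slice_value J w"
  shows "star_prod f g (emb I z) = slice_value I (stem_mult v w)"
proof -
  define a where "a = f (emb I z)"
  define x where "x b = Re (w b)" for b
  define y where "y b = Im (w b)" for b
  have emb_w: "emb J (w b) = of_real (x b) + J * of_real (y b)" for J b
    by (simp add: emb_def x_def y_def)
  have "slice_value I (stem_mult v w) = (\<Sum>b\<in>std_basis. \<Sum>c\<in>std_basis. emb I (w b) * (emb I (v c) * c) * b)"
    unfolding slice_value_stem_mult[OF assms(1)]
    by (subst sum.swap) (simp add: mult.commute[of "v b" "w c" for b c] emb_mult[OF assms(1)] mult.assoc)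
  also have "\<dots> = (\<Sum>b\<in>std_basis. emb I (w b) * a * b)"
    unfolding a_def f by (simp add: slice_value_def sum_distrib_left sum_distrib_right)
  finally have R: "slice_value I (stem_mult v w) = (\<Sum>b\<in>std_basis. emb I (w b) * a * b)" .
  show ?thesis
  proof (cases "a = 0")
    case True
    thus ?thesis unfolding R by (simp add: star_prod_def a_def)
  next
    case False
    define J where "J = inverse a * I * a"
    have aJ: "a * J = I * a" using False by (simp add: J_def flip: mult.assoc)
    have "J * J = inverse a * (I * I) * a"
      using False by (simp add: J_def mult.assoc) (simp add: mult.assoc[symmetric])
    hence J: "J \<in> \<S>"
      using False by (simp add: imag_units_square[OF assms(1)] imag_units_def power2_eq_square)
    have comm: "a * emb J c = emb I c * a" for c
    proof -
      have "a * emb J c = of_real (Re c) * a + (a * J) * of_real (Im c)"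
        by (simp add: emb_def distrib_left mult.assoc of_real_quat_commute)
      thus ?thesis
        by (simp add: emb_def aJ distrib_right mult.assoc of_real_quat_commute)
    qed
    hence "inverse a * emb I z * a = emb J z"
      using False comm[of z] by (metis mult.assoc left_inverse mult_1)
    hence "star_prod f g (emb I z) = a * slice_value J w"
      using False g[OF J] by (simp add: star_prod_def a_def)
    also have "\<dots> = (\<Sum>b\<in>std_basis. a * emb J (w b) * b)"
      by (simp add: slice_value_def sum_distrib_left mult.assoc)
    also have "\<dots> = (\<Sum>b\<in>std_basis. emb I (w b) * a * b)"
      by (simp only: comm)
    finally show ?thesis unfolding R .
  qed
qed

section \<open>Semi-regular functions as meromorphic stems\<close>

text \<open>The slices of \<open>I\<close> and \<open>- I\<close> together separate the real and the imaginary parts of the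
  coordinates.\<close>

lemma slice_value_inject:
  assumes eq: "\<And>I. I \<in> \<S> \<Longrightarrow> slice_value I v = slice_value I w" and e: "e \<in> std_basis"
  shows "v e = w e"
proof -
  have "slice_value ref_unit v = slice_value ref_unit w" "slice_value (- ref_unit) v = slice_value (- ref_unit) w"
    by (auto intro!: eq imag_units_uminus)
  hence "v 1 = w 1 \<and> v (Quat 0 1 0 0) = w (Quat 0 1 0 0) \<and>
      v (Quat 0 0 1 0) = w (Quat 0 0 1 0) \<and> v (Quat 0 0 0 1) = w (Quat 0 0 0 1)"
    unfolding slice_value_def sum_std_basis
    by (simp add: quat_eq_iff[of "_ + _"] emb_def quat_sel_times ref_unit_def complex_eq_iff)
  thus ?thesis using e by (auto simp: std_basis_def)
qed

lemma emb_eq_emb_cases: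
  assumes "I \<in> \<S>" "J \<in> \<S>" "emb I w = emb J z"
  shows "w = z \<or> w = cnj z"
proof -
  have "height (emb I w) = height (emb J z)" by (simp only: assms(3))
  thus ?thesis unfolding height_emb[OF assms(1)] height_emb[OF assms(2)]
    by (auto simp: complex_eq_iff abs_eq_iff)
qed

definition fun_of_stem :: "(quat \<Rightarrow> complex \<Rightarrow> complex) \<Rightarrow> quat \<Rightarrow> quat" where
  "fun_of_stem \<Phi> q = slice_value (axis q) (\<lambda>e. \<Phi> e (height q))"

lemma slice_value_cong:
  "(\<And>e. e \<in> std_basis \<Longrightarrow> v e = w e) \<Longrightarrow> slice_value I v = slice_value I w"
  by (simp add: slice_value_def)

text \<open>The mirror symmetry makes the value independent of the way in which a quaternion is
  written as \<open>x + I y\<close>.\<close>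

lemma fun_of_stem_emb:
  assumes I: "I \<in> \<S>" and sym: "\<And>e. e \<in> std_basis \<Longrightarrow> \<Phi> e (cnj z) = cnj (\<Phi> e z)"
  shows "fun_of_stem \<Phi> (emb I z) = slice_value I (\<lambda>e. \<Phi> e z)"
proof -
  define J h where "J = axis (emb I z)" and "h = height (emb I z)"
  have eq: "emb J h = emb I z" by (simp add: J_def h_def emb_axis_height)
  have cancel: "K = I" if "emb K z = emb I z" "Im z \<noteq> 0" for K
  proof -
    have "K * of_real (Im z) = I * of_real (Im z)" using that by (simp add: emb_def)
    thus ?thesis using that(2) by simp
  qed
  consider "Im z = 0" | "Im z \<noteq> 0" "h = z" | "Im z \<noteq> 0" "h = cnj z"
    using height_emb_cases[OF I, of z] by (auto simp: h_def)
  hence "slice_value J (\<lambda>e. \<Phi> e h) = slice_value I (\<lambda>e. \<Phi> e z)"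
  proof cases
    case 1
    hence z: "cnj z = z" by (simp add: complex_eq_iff)
    hence "h = z" using height_emb_cases[OF I, of z] by (auto simp: h_def)
    moreover have "emb J (\<Phi> e z) = emb I (\<Phi> e z)" if "e \<in> std_basis" for e
    proof -
      have "Im (\<Phi> e z) = 0" using sym[OF that] z by (metis complex_cnj cancel_comm_monoid_add_class.diff_cancel
            complex.sel(2) complex_surj neg_equal_zero)
      thus ?thesis by (simp add: emb_def)
    qed
    ultimately show ?thesis by (simp add: slice_value_def)
  next
    case 2
    thus ?thesis using cancel[of J] eq by simp
  next
    case 3
    hence "emb (- J) z = emb I z" using eq emb_cnj[of J z] by simp
    hence "- J = I" using cancel[of "- J"] 3 by blast
    moreover have "slice_value J (\<lambda>e. \<Phi> e (cnj z)) = slice_value (- J) (\<lambda>e. \<Phi> e z)"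
      unfolding slice_value_cnj[symmetric] by (rule slice_value_cong) (rule sym)
    ultimately show ?thesis using 3 by simp
  qed
  thus ?thesis by (simp add: fun_of_stem_def J_def h_def)
qed

definition mero_stem :: "quat set \<Rightarrow> (quat \<Rightarrow> complex \<Rightarrow> complex) \<Rightarrow> bool" where
  "mero_stem \<Omega> \<Phi> \<longleftrightarrow> (\<forall>e\<in>std_basis. \<Phi> e meromorphic_on shadow \<Omega> \<and>
     (\<forall>z\<in>shadow \<Omega>. \<Phi> e (cnj z) = cnj (\<Phi> e z)))"

text \<open>Analyticity at all points of the domain, rather than meromorphy, lets the identity
  theorem give equality of values at each of them.\<close>

definition has_stem :: "(quat \<rightharpoonup> quat) \<Rightarrow> (quat \<Rightarrow> complex \<Rightarrow> complex) \<Rightarrow> bool" where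
  "has_stem f \<Phi> \<longleftrightarrow> (\<forall>z\<in>shadow (dom f).
     (\<forall>e\<in>std_basis. \<Phi> e analytic_on {z}) \<and>
     (\<forall>I\<in>\<S>. f (emb I z) = Some (slice_value I (\<lambda>e. \<Phi> e z))))"

text \<open>The possible domains of representatives: their complement in \<open>\<Omega>\<close> consists of isolated real
  points and isolated spheres.\<close>

definition codiscrete :: "quat set \<Rightarrow> quat set \<Rightarrow> bool" where
  "codiscrete \<Omega> W \<longleftrightarrow> W \<subseteq> \<Omega> \<and> open W \<and> circular W \<and>
     (\<forall>z\<in>shadow \<Omega>. \<forall>\<^sub>F w in at z. w \<in> shadow W)"

lemma shadow_Int: "shadow (U \<inter> V) = shadow U \<inter> shadow V"
  by (auto simp: shadow_def)

lemma shadow_mono: "U \<subseteq> V \<Longrightarrow> shadow U \<subseteq> shadow V"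
  by (auto simp: shadow_def)

lemma codiscrete_Int: "codiscrete \<Omega> U \<Longrightarrow> codiscrete \<Omega> V \<Longrightarrow> codiscrete \<Omega> (U \<inter> V)"
  by (auto simp: codiscrete_def circular_def shadow_Int eventually_conj_iff)

text \<open>The stem is meromorphic at a pole because the stem of the extension of
  \<open>\<Delta> p ^ m * f\<close> is the stem of \<open>f\<close> multiplied by \<open>((w - z) * (w - cnj z)) ^ m\<close>.\<close>

lemma semi_regular_imp_stem:
  assumes semi: "semi_regular \<Omega> f" and \<Omega>: "open \<Omega>" "circular \<Omega>"
  shows "mero_stem \<Omega> (stem (the \<circ> f))" "has_stem f (stem (the \<circ> f))" "codiscrete \<Omega> (dom f)"
proof -
  let ?D = "dom f" and ?f = "the \<circ> f"
  have D: "?D \<subseteq> \<Omega>" "open ?D" "circular ?D" "slice_regular ?D ?f"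
    using semi by (auto simp: semi_regular_def)
  have sf: "slice_function ?D ?f" using D(4) by (simp add: slice_regular_def)
  have ana: "stem ?f e analytic_on {z}" if "z \<in> shadow ?D" for e z
    using holomorphic_on_stem[OF D(4,3,2)] open_shadow[OF D(2)] that
    by (metis holomorphic_on_imp_analytic_at)
  show "has_stem f (stem ?f)"
    unfolding has_stem_def
  proof (intro ballI conjI)
    fix z I assume z: "z \<in> shadow ?D" and I: "I \<in> \<S>"
    hence "emb I z \<in> ?D" using emb_in_circular_iff[OF D(3)] by blast
    moreover have "?f (emb I z) = slice_value I (\<lambda>e. stem ?f e z)"
      by (rule slice_function_stem[OF sf D(3) z I])
    ultimately show "f (emb I z) = Some (slice_value I (\<lambda>e. stem ?f e z))" by auto
  qed (rule ana)
  have pole: "(\<forall>\<^sub>F w in at z. w \<in> shadow ?D) \<and> (\<forall>e\<in>std_basis. stem ?f e meromorphic_on {z})"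
    if z: "z \<in> shadow \<Omega>" for z
  proof (cases "z \<in> shadow ?D")
    case True
    thus ?thesis using ana eventually_at_in_open'[OF open_shadow[OF D(2)] True]
      by (auto intro: analytic_on_imp_meromorphic_on)
  next
    case False
    define p where "p = emb ref_unit z"
    have "p \<in> \<Omega> - ?D" using z False by (simp add: p_def shadow_def)
    then obtain U m g where U: "open U" "circular U" "p \<in> U" "U - qsphere p \<subseteq> ?D"
      "slice_regular U g" "\<And>q. q \<in> U - qsphere p \<Longrightarrow> g q = \<Delta> p q ^ m * the (f q)"
      using semi unfolding semi_regular_def by metis
    have zU: "z \<in> shadow U" using U(3) by (simp add: p_def shadow_def)
    define \<delta> where "\<delta> w = (w - z) * (w - cnj z)" for w
    have off: "emb I w \<in> U - qsphere p" if "w \<in> shadow U" "w \<noteq> z" "w \<noteq> cnj z" "I \<in> \<S>" for w I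
      using that emb_in_circular_iff[OF U(2) that(4), of w] emb_eq_emb_cases[OF that(4)]
      by (auto simp: p_def qsphere_emb)
    have ev: "\<forall>\<^sub>F w in at z. w \<in> shadow U \<and> w \<noteq> z \<and> w \<noteq> cnj z"
      using eventually_at_in_open'[OF open_shadow[OF U(1)] zU]
      by (intro eventually_conj eventually_neq_at_within)
    have "\<forall>\<^sub>F w in at z. w \<in> shadow ?D"
      using ev by eventually_elim (use off[OF _ _ _ ref_unit_imag_unit] U(4) in \<open>auto simp: shadow_def\<close>)
    moreover have "stem ?f e meromorphic_on {z}" if e: "e \<in> std_basis" for e
    proof -
      have "stem g e analytic_on {z}"
        using holomorphic_on_stem[OF U(5,2,1)] open_shadow[OF U(1)] zU
        by (metis holomorphic_on_imp_analytic_at)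
      hence "stem g e meromorphic_on {z}" by (rule analytic_on_imp_meromorphic_on)
      hence "(\<lambda>w. stem g e w / \<delta> w ^ m) meromorphic_on {z}"
        unfolding \<delta>_def by (intro meromorphic_intros)
      moreover have "\<forall>\<^sub>F w in at z. stem g e w / \<delta> w ^ m = stem ?f e w"
        using ev
      proof eventually_elim
        case (elim w)
        have "stem g e w = \<delta> w ^ m * stem ?f e w"
        proof (rule slice_value_inject[OF _ e])
          fix I assume I: "I \<in> \<S>"
          have q: "emb I w \<in> U - qsphere p" using elim off I by blast
          hence "w \<in> shadow ?D" using U(4) emb_in_circular_iff[OF D(3) I] by blast
          hence "?f (emb I w) = slice_value I (\<lambda>e. stem ?f e w)"
            by (rule slice_function_stem[OF sf D(3) _ I])
          moreover have "g (emb I w) = slice_value I (\<lambda>e. stem g e w)"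
            using elim U(5) by (intro slice_function_stem[OF _ U(2) _ I]) (auto simp: slice_regular_def)
          moreover have "\<Delta> p (emb I w) = emb I (\<delta> w)"
            unfolding p_def \<delta>_def by (rule \<Delta>_emb[OF I ref_unit_imag_unit])
          ultimately show "slice_value I (\<lambda>e. stem g e w) = slice_value I (\<lambda>e. \<delta> w ^ m * stem ?f e w)"
            using U(6)[OF q] by (simp add: slice_value_mult[OF I] emb_power[OF I])
        qed
        moreover have "\<delta> w \<noteq> 0" using elim by (simp add: \<delta>_def)
        ultimately show ?case by simp
      qed
      ultimately show ?thesis
        using meromorphic_on_cong[of "{z}" "\<lambda>w. stem g e w / \<delta> w ^ m" "stem ?f e" "{z}"] by simp
    qed
    ultimately show ?thesis by blast
  qed
  show "mero_stem \<Omega> (stem ?f)"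
    unfolding mero_stem_def using pole meromorphic_on_meromorphic_at stem_cnj by blast
  show "codiscrete \<Omega> ?D" unfolding codiscrete_def using D pole by blast
qed

lemma filtermap_cnj_at: "filtermap cnj (at z) = at (cnj z)"
proof -
  have lim: "filterlim cnj (at (cnj w)) (at w)" for w
    by (auto simp: filterlim_at eventually_at_filter intro!: tendsto_eq_intros)
  show ?thesis
    using lim[of z] lim[of "cnj z"] by (intro filtermap_fun_inverse[of cnj]) simp_all
qed

lemma eventually_at_cnj: "eventually P (at (cnj z)) \<longleftrightarrow> (\<forall>\<^sub>F w in at z. P (cnj w))"
  by (simp add: filtermap_cnj_at[symmetric] eventually_filtermap)

lemma tendsto_mirror:
  assumes "F \<midarrow>z\<rightarrow> c" "\<forall>\<^sub>F w in at z. F (cnj w) = cnj (F w)"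
  shows "F \<midarrow>cnj z\<rightarrow> cnj c"
proof -
  have "((\<lambda>w. cnj (F w)) \<longlongrightarrow> cnj c) (at z)" using assms(1) by (intro tendsto_intros)
  hence "((\<lambda>w. F (cnj w)) \<longlongrightarrow> cnj c) (at z)"
    by (rule Lim_transform_eventually) (use assms(2) in \<open>auto elim: eventually_mono\<close>)
  thus ?thesis by (simp add: filtermap_cnj_at[symmetric] filterlim_filtermap)
qed

text \<open>The largest of the pole orders serves as the exponent.\<close>

lemma meromorphic_common_denominator:
  assumes "finite B" "\<And>e. e \<in> B \<Longrightarrow> \<Phi> e meromorphic_on {z}"
  obtains m where "\<And>e. e \<in> B \<Longrightarrow> \<exists>c. (\<lambda>w. (w - z) ^ m * \<Phi> e w) \<midarrow>z\<rightarrow> c"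
proof -
  define F where "F e = laurent_expansion (\<Phi> e) z" for e
  have F: "(\<lambda>w. \<Phi> e (z + w)) has_laurent_expansion F e" if "e \<in> B" for e
    using meromorphic_on_imp_has_laurent_expansion[OF assms(2)[OF that]] by (simp add: F_def)
  define m where "m = Max (insert 0 ((\<lambda>e. nat (- fls_subdegree (F e))) ` B))"
  have "\<exists>c. (\<lambda>w. (w - z) ^ m * \<Phi> e w) \<midarrow>z\<rightarrow> c" if e: "e \<in> B" for e
  proof -
    have "nat (- fls_subdegree (F e)) \<le> m" unfolding m_def using assms(1) e by (intro Max_ge) auto
    hence m: "int m \<ge> - fls_subdegree (F e)" by linarith
    have "(\<lambda>w. w ^ m * \<Phi> e (z + w)) has_laurent_expansion fls_X ^ m * F e"
      by (intro laurent_expansion_intros F e)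
    hence "(\<lambda>w. ((z + w) - z) ^ m * \<Phi> e (z + w)) has_laurent_expansion fls_X ^ m * F e"
      by simp
    moreover have "fls_subdegree (fls_X ^ m * F e) \<ge> 0"
      using m by (cases "F e = 0") (simp_all add: fls_subdegree_mult fls_subdegree_pow)
    ultimately show ?thesis
      using has_laurent_expansion_imp_tendsto[of "\<lambda>w. (w - z) ^ m * \<Phi> e w" z] by blast
  qed
  thus ?thesis using that by blast
qed

text \<open>At a point \<open>z\<close> of the shadow outside the domain, multiplication by a power of
  \<open>(w - z) * (w - cnj z)\<close> makes the coefficients bounded at \<open>z\<close>, hence by symmetry also at \<open>cnj z\<close>.
  Removing the singularities gives a symmetric holomorphic stem on two discs, whose function extends
  \<open>\<Delta> p ^ m * f\<close>.\<close>

lemma stem_imp_semi_regular: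
  assumes \<Omega>: "open \<Omega>" "circular \<Omega>"
    and mero: "mero_stem \<Omega> \<Phi>" and stem: "has_stem f \<Phi>" and codiscrete: "codiscrete \<Omega> (dom f)"
  shows "semi_regular \<Omega> f"
  unfolding semi_regular_def
proof (intro conjI ballI)
  have D: "dom f \<subseteq> \<Omega>" "open (dom f)" "circular (dom f)"
    and ev: "\<And>z. z \<in> shadow \<Omega> \<Longrightarrow> \<forall>\<^sub>F w in at z. w \<in> shadow (dom f)"
    using codiscrete by (auto simp: codiscrete_def)
  show "dom f \<subseteq> \<Omega>" "open (dom f)" "circular (dom f)" by fact+
  have sym: "\<Phi> e (cnj z) = cnj (\<Phi> e z)" if "e \<in> std_basis" "z \<in> shadow \<Omega>" for e z
    using mero that by (simp add: mero_stem_def)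
  have ana: "\<Phi> e analytic_on {z}" if "e \<in> std_basis" "z \<in> shadow (dom f)" for e z
    using stem that by (simp add: has_stem_def)
  show "slice_regular (dom f) (the \<circ> f)"
  proof (rule slice_regular_of_stem)
    show "\<Phi> e holomorphic_on shadow (dom f)" if "e \<in> std_basis" for e
      using ana[OF that] analytic_on_analytic_at analytic_imp_holomorphic by blast
    show "\<Phi> e (cnj z) = cnj (\<Phi> e z)" if "e \<in> std_basis" "z \<in> shadow (dom f)" for e z
      using sym that shadow_mono[OF D(1)] by blast
    show "(the \<circ> f) (emb I z) = slice_value I (\<lambda>e. \<Phi> e z)" if "I \<in> \<S>" "z \<in> shadow (dom f)" for I z
      using stem that by (simp add: has_stem_def)
  qed fact+
  fix p assume p: "p \<in> \<Omega> - dom f"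
  define z where "z = height p"
  have pz: "p = emb (axis p) z" by (simp add: z_def emb_axis_height)
  have z: "z \<in> shadow \<Omega>" using p height_in_shadow[OF \<Omega>(2)] by (simp add: z_def)
  have "\<forall>\<^sub>F w in at z. w \<in> shadow (dom f)" by (rule ev[OF z])
  then obtain r where r: "r > 0" "\<And>w. w \<in> ball z r \<Longrightarrow> w \<noteq> z \<Longrightarrow> w \<in> shadow (dom f)"
    unfolding eventually_at by (auto simp: dist_commute)
  define N where "N = ball z r \<union> ball (cnj z) r"
  have cnj_ball: "cnj w \<in> ball (cnj z) r \<longleftrightarrow> w \<in> ball z r" for w z
    unfolding mem_ball dist_norm using complex_mod_cnj[of "z - w"] by simp
  have cnj_N: "cnj w \<in> N \<longleftrightarrow> w \<in> N" for w
    using cnj_ball[of w z] cnj_ball[of w "cnj z"] by (auto simp: N_def)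
  have N_dom: "w \<in> shadow (dom f)" if "w \<in> N" "w \<noteq> z" "w \<noteq> cnj z" for w
  proof (cases "w \<in> ball z r")
    case False
    hence "cnj w \<in> ball z r" using that cnj_ball[of "cnj w" z] by (simp add: N_def)
    hence "cnj w \<in> shadow (dom f)" using that by (intro r(2)) auto
    thus ?thesis using shadow_cnj[OF D(3)] by blast
  qed (use that r(2) in blast)
  have N_\<Omega>: "w \<in> shadow \<Omega>" if "w \<in> N" for w
    using N_dom[OF that] z shadow_cnj[OF \<Omega>(2), of z] shadow_mono[OF D(1)] by blast
  have zN: "z \<in> N" "cnj z \<in> N" using r(1) by (auto simp: N_def)
  define \<delta> where "\<delta> w = (w - z) * (w - cnj z)" for w
  have \<delta>_cnj: "\<delta> (cnj w) = cnj (\<delta> w)" for w by (simp add: \<delta>_def)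
  have mero_z: "\<Phi> e meromorphic_on {w}" if "e \<in> std_basis" "w \<in> shadow \<Omega>" for e w
    using mero that by (auto simp: mero_stem_def intro: meromorphic_on_subset)
  obtain m where m: "\<And>e. e \<in> std_basis \<Longrightarrow> \<exists>c. (\<lambda>w. (w - z) ^ m * \<Phi> e w) \<midarrow>z\<rightarrow> c"
    using meromorphic_common_denominator[of std_basis \<Phi> z] mero_z z finite_std_basis by metis
  define F where "F e w = \<delta> w ^ m * \<Phi> e w" for e w
  define \<Psi> where "\<Psi> e = remove_sings (F e)" for e
  have F_sym: "F e (cnj w) = cnj (F e w)" if "e \<in> std_basis" "w \<in> shadow \<Omega>" for e w
    using sym[OF that] by (simp add: F_def \<delta>_cnj)
  have F_sym_ev: "\<forall>\<^sub>F v in at w. F e (cnj v) = cnj (F e v)"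
    if "e \<in> std_basis" "w \<in> N" for e w
    using eventually_at_in_open'[OF open_shadow[OF \<Omega>(1)] N_\<Omega>[OF that(2)]]
    by eventually_elim (rule F_sym[OF that(1)])
  have F_ana: "F e analytic_on {w}" if "e \<in> std_basis" "w \<in> shadow (dom f)" for e w
    unfolding F_def \<delta>_def by (intro analytic_intros ana that)
  have F_lim: "\<exists>c. F e \<midarrow>w\<rightarrow> c" if e: "e \<in> std_basis" and w: "w \<in> N" for e w
  proof -
    obtain c where "(\<lambda>w. (w - z) ^ m * \<Phi> e w) \<midarrow>z\<rightarrow> c" using m[OF e] by blast
    hence "(\<lambda>w. (w - cnj z) ^ m * ((w - z) ^ m * \<Phi> e w)) \<midarrow>z\<rightarrow> (z - cnj z) ^ m * c"
      by (intro tendsto_intros)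
    hence lim: "F e \<midarrow>z\<rightarrow> (z - cnj z) ^ m * c"
      by (simp add: F_def[abs_def] \<delta>_def power_mult_distrib ac_simps)
    show ?thesis
    proof (cases "w = z \<or> w = cnj z")
      case True
      thus ?thesis using lim tendsto_mirror[OF lim F_sym_ev[OF e zN(1)]] by blast
    next
      case False
      hence "F e analytic_on {w}" using F_ana[OF e] N_dom w by blast
      thus ?thesis using analytic_at_imp_isCont isContD by blast
    qed
  qed
  have \<Psi>_ana: "\<Psi> e analytic_on {w}" if e: "e \<in> std_basis" and w: "w \<in> N" for e w
  proof -
    have "F e meromorphic_on {w}"
      unfolding F_def \<delta>_def by (intro meromorphic_intros mero_z e N_\<Omega> w)
    thus ?thesis
      unfolding \<Psi>_def using F_lim[OF e w] remove_sings_analytic_at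
        meromorphic_on_isolated_singularity by blast
  qed
  have \<Psi>_sym: "\<Psi> e (cnj w) = cnj (\<Psi> e w)" if e: "e \<in> std_basis" and w: "w \<in> N" for e w
  proof -
    obtain c where c: "F e \<midarrow>w\<rightarrow> c" using F_lim[OF e w] by blast
    have "F e \<midarrow>cnj w\<rightarrow> cnj c" by (rule tendsto_mirror[OF c F_sym_ev[OF e w]])
    thus ?thesis using c remove_sings_eqI unfolding \<Psi>_def by metis
  qed
  have shadow_N: "shadow (sweep N) = N" by (rule shadow_sweep) (rule cnj_N)
  define g where "g = fun_of_stem \<Psi>"
  have g: "g (emb I w) = slice_value I (\<lambda>e. \<Psi> e w)" if "I \<in> \<S>" "w \<in> N" for I w
    unfolding g_def by (rule fun_of_stem_emb[OF that(1)]) (rule \<Psi>_sym[OF _ that(2)])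
  show "\<exists>U m g. open U \<and> circular U \<and> p \<in> U \<and> U \<subseteq> \<Omega> \<and> U - qsphere p \<subseteq> dom f \<and>
      slice_regular U g \<and> (\<forall>q\<in>U - qsphere p. g q = \<Delta> p q ^ m * the (f q))"
  proof (intro exI conjI ballI subsetI)
    show "open (sweep N)" by (rule open_sweep) (simp only: N_def open_Un open_ball)
    show "circular (sweep N)" by (rule circular_sweep)
    show "p \<in> sweep N" using zN by (simp add: sweep_def z_def)
    show "q \<in> \<Omega>" if "q \<in> sweep N" for q
      using that N_\<Omega> height_in_shadow[OF \<Omega>(2)] by (auto simp: sweep_def)
    have off: "height q \<in> N" "height q \<noteq> z" "height q \<noteq> cnj z" if "q \<in> sweep N - qsphere p" for q
    proof -
      have S: "qsphere p = {emb J z | J. J \<in> \<S>}"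
        using qsphere_emb[OF axis_imag_unit[of p], of z] by (simp add: pz[symmetric])
      have q: "q = emb (axis q) (height q)" by (simp add: emb_axis_height)
      show "height q \<in> N" using that by (simp add: sweep_def)
      show "height q \<noteq> z" using that q S axis_imag_unit by blast
      show "height q \<noteq> cnj z"
      proof
        assume "height q = cnj z"
        hence "q = emb (- axis q) z" using q emb_cnj by metis
        thus False using that S imag_units_uminus[OF axis_imag_unit] by blast
      qed
    qed
    show "q \<in> dom f" if "q \<in> sweep N - qsphere p" for q
      using N_dom off[OF that] height_in_shadow[OF D(3)] by blast
    show "slice_regular (sweep N) g"
    proof (rule slice_regular_of_stem)
      show "\<Psi> e holomorphic_on shadow (sweep N)" if "e \<in> std_basis" for e
        unfolding shadow_N
        using \<Psi>_ana[OF that] analytic_on_analytic_at analytic_imp_holomorphic by blast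
      show "\<Psi> e (cnj w) = cnj (\<Psi> e w)" if "e \<in> std_basis" "w \<in> shadow (sweep N)" for e w
        using \<Psi>_sym that unfolding shadow_N by blast
      show "g (emb I w) = slice_value I (\<lambda>e. \<Psi> e w)" if "I \<in> \<S>" "w \<in> shadow (sweep N)" for I w
        using g that unfolding shadow_N by blast
      show "open (sweep N)" by (rule open_sweep) (simp only: N_def open_Un open_ball)
      show "circular (sweep N)" by (rule circular_sweep)
    qed
    show "g q = \<Delta> p q ^ m * the (f q)" if q: "q \<in> sweep N - qsphere p" for q
    proof -
      define I w where "I = axis q" and "w = height q"
      have I: "I \<in> \<S>" and qw: "q = emb I w" by (simp_all add: I_def w_def emb_axis_height)
      have w: "w \<in> N" "w \<in> shadow (dom f)" using off[OF q] N_dom by (auto simp: w_def)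
      have "g q = slice_value I (\<lambda>e. \<Psi> e w)" unfolding qw by (rule g[OF I w(1)])
      also have "\<dots> = slice_value I (\<lambda>e. F e w)"
        unfolding \<Psi>_def by (rule slice_value_cong) (simp add: F_ana w)
      also have "\<dots> = emb I (\<delta> w) ^ m * slice_value I (\<lambda>e. \<Phi> e w)"
        by (simp add: F_def slice_value_mult[OF I] emb_power[OF I])
      also have "emb I (\<delta> w) = \<Delta> p q"
        unfolding qw \<delta>_def by (rule \<Delta>_emb[OF I axis_imag_unit[of p], of z w, folded pz, symmetric])
      also have "slice_value I (\<lambda>e. \<Phi> e w) = the (f q)"
        using stem w(2) I by (simp add: has_stem_def qw)
      finally show ?thesis .
    qed
  qed
qed

text \<open>The largest possible domain works: all points at which the coefficients are analytic.\<close>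

lemma exists_semi_regular:
  assumes \<Omega>: "open \<Omega>" "circular \<Omega>" and mero: "mero_stem \<Omega> \<Phi>"
  obtains f where "semi_regular \<Omega> f" "has_stem f \<Phi>"
proof -
  define A where "A = {z\<in>shadow \<Omega>. \<forall>e\<in>std_basis. \<Phi> e analytic_on {z} \<and> \<Phi> e analytic_on {cnj z}}"
  have cnj_A: "cnj z \<in> A \<longleftrightarrow> z \<in> A" for z
    using shadow_cnj[OF \<Omega>(2), of z] by (auto simp: A_def)
  have shadow_A: "shadow (sweep A) = A" by (rule shadow_sweep) (rule cnj_A)
  have sing: "\<forall>\<^sub>F w in at z. w \<in> A" if z: "z \<in> shadow \<Omega>" for z
  proof -
    have *: "\<forall>\<^sub>F w in at v. \<forall>e\<in>std_basis. \<Phi> e analytic_on {w}" if "v \<in> shadow \<Omega>" for v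
    proof (rule eventually_ball_finite[OF finite_std_basis], rule ballI)
      fix e assume "e \<in> std_basis"
      hence "\<Phi> e meromorphic_on shadow \<Omega>" using mero by (simp add: mero_stem_def)
      thus "\<forall>\<^sub>F w in at v. \<Phi> e analytic_on {w}"
        using meromorphic_on_imp_analytic_cosparse eventually_cosparse_imp_eventually_at that by blast
    qed
    have "\<forall>\<^sub>F w in at (cnj z). \<forall>e\<in>std_basis. \<Phi> e analytic_on {w}"
      using * z shadow_cnj[OF \<Omega>(2)] by blast
    hence "\<forall>\<^sub>F w in at z. \<forall>e\<in>std_basis. \<Phi> e analytic_on {cnj w}"
      by (simp add: eventually_at_cnj)
    thus ?thesis
      using *[OF z] eventually_at_in_open'[OF open_shadow[OF \<Omega>(1)] z]
      by eventually_elim (auto simp: A_def)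
  qed
  have open_A: "open A"
  proof -
    have "open {z. \<Phi> e analytic_on {z}}" for e
    proof (subst open_subopen, safe)
      fix z assume "\<Phi> e analytic_on {z}"
      then obtain T where "open T" "z \<in> T" "\<Phi> e holomorphic_on T" by (auto simp: analytic_at)
      thus "\<exists>T. open T \<and> z \<in> T \<and> T \<subseteq> {z. \<Phi> e analytic_on {z}}"
        using holomorphic_on_imp_analytic_at by (intro exI[of _ T]) blast
    qed
    hence "open (\<Inter>e\<in>std_basis. {z. \<Phi> e analytic_on {z}} \<inter> cnj -` {z. \<Phi> e analytic_on {z}})"
      by (intro open_INT finite_std_basis ballI open_Int open_vimage) (auto intro: continuous_intros)
    moreover have "A = shadow \<Omega> \<inter>
        (\<Inter>e\<in>std_basis. {z. \<Phi> e analytic_on {z}} \<inter> cnj -` {z. \<Phi> e analytic_on {z}})"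
      by (auto simp: A_def)
    ultimately show ?thesis using open_shadow[OF \<Omega>(1)] by auto
  qed
  define f where "f = (\<lambda>q. Some (fun_of_stem \<Phi> q)) |` sweep A"
  have dom: "dom f = sweep A" by (auto simp: f_def restrict_map_def split: if_splits)
  have "has_stem f \<Phi>"
    unfolding has_stem_def dom shadow_A
  proof (intro ballI conjI)
    fix z assume z: "z \<in> A"
    thus "\<Phi> e analytic_on {z}" if "e \<in> std_basis" for e using that by (simp add: A_def)
    fix I assume I: "I \<in> \<S>"
    have "emb I z \<in> sweep A" using emb_in_sweep_iff[of A, OF cnj_A I] z by blast
    moreover have "fun_of_stem \<Phi> (emb I z) = slice_value I (\<lambda>e. \<Phi> e z)"
      using mero z by (intro fun_of_stem_emb I) (auto simp: mero_stem_def A_def)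
    ultimately show "f (emb I z) = Some (slice_value I (\<lambda>e. \<Phi> e z))" by (simp add: f_def)
  qed
  moreover have "codiscrete \<Omega> (dom f)"
    unfolding codiscrete_def dom shadow_A
  proof (intro conjI ballI)
    show "sweep A \<subseteq> \<Omega>" using height_in_shadow[OF \<Omega>(2)] by (auto simp: sweep_def A_def)
  qed (use open_sweep[OF open_A] circular_sweep sing in blast)+
  ultimately show ?thesis
    using that stem_imp_semi_regular[OF \<Omega> mero] by blast
qed

section \<open>Germs along the real axis\<close>

definition real_germ :: "(quat \<rightharpoonup> quat) \<Rightarrow> real \<Rightarrow> quat" where
  "real_germ f x = the (f (of_real x))"

definition stem_germ :: "(quat \<Rightarrow> complex \<Rightarrow> complex) \<Rightarrow> real \<Rightarrow> quat" where
  "stem_germ \<Phi> x = slice_value ref_unit (\<lambda>e. \<Phi> e (of_real x))"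

text \<open>At a real point the symmetry forces real coefficients, so they are the coordinates of the
  value.\<close>

lemma mero_stem_real:
  assumes "mero_stem \<Omega> \<Phi>" "e \<in> std_basis" "of_real x \<in> shadow \<Omega>"
  shows "\<Phi> e (of_real x) = of_real (inner e (stem_germ \<Phi> x))"
proof -
  define t where "t a = Re (\<Phi> a (of_real x))" for a
  have t: "\<Phi> a (of_real x) = of_real (t a)" if "a \<in> std_basis" for a
  proof -
    have "cnj (\<Phi> a (of_real x)) = \<Phi> a (of_real x)"
      using assms that unfolding mero_stem_def by (metis complex_cnj_complex_of_real)
    thus ?thesis by (simp add: complex_eq_iff t_def)
  qed
  have "stem_germ \<Phi> x = (\<Sum>a\<in>std_basis. of_real (t a) * a)"
    unfolding stem_germ_def slice_value_def by (rule sum.cong) (simp_all add: t)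
  also have "inner e \<dots> = t e"
    using assms(2) unfolding sum_std_basis
    by (auto simp: std_basis_def inner_quat_def quat_sel_times)
  finally show ?thesis using t[OF assms(2)] by simp
qed

locale slice_domain_at =
  fixes \<Omega> :: "quat set" and r :: real
  assumes slice_dom: "slice_domain \<Omega>" and r: "of_real r \<in> \<Omega>"
begin

lemma \<Omega>: "open \<Omega>" "circular \<Omega>" "connected \<Omega>"
  using slice_dom by (auto simp: slice_domain_def)

lemma r_shadow: "of_real r \<in> shadow \<Omega>"
  using r by (simp add: shadow_def)

lemma eventually_at_real:
  fixes P :: "complex \<Rightarrow> bool"
  assumes "\<forall>\<^sub>F w in at (of_real r). P w"
  shows "\<forall>\<^sub>F x in at r. P (of_real x)"
proof -
  have "filterlim (of_real :: real \<Rightarrow> complex) (at (of_real r)) (at r)"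
    by (auto simp: filterlim_at eventually_at_filter intro!: tendsto_eq_intros)
  thus ?thesis using assms by (simp add: filterlim_iff)
qed

lemma eventually_real_in_shadow: "\<forall>\<^sub>F x in at r. of_real x \<in> shadow \<Omega>"
  by (rule eventually_at_real) (rule eventually_at_in_open'[OF open_shadow[OF \<Omega>(1)] r_shadow])

lemma eventually_real_germ:
  assumes "has_stem f \<Phi>" "codiscrete \<Omega> (dom f)"
  shows "\<forall>\<^sub>F x in at r. of_real x \<in> dom f \<and> real_germ f x = stem_germ \<Phi> x"
proof -
  have "\<forall>\<^sub>F w in at (of_real r). w \<in> shadow (dom f)"
    using assms(2) r_shadow by (auto simp: codiscrete_def)
  hence "\<forall>\<^sub>F x in at r. of_real x \<in> shadow (dom f)" by (rule eventually_at_real)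
  thus ?thesis
  proof eventually_elim
    case (elim x)
    have "f (emb ref_unit (of_real x)) = Some (slice_value ref_unit (\<lambda>e. \<Phi> e (of_real x)))"
      using assms(1) elim ref_unit_imag_unit unfolding has_stem_def by blast
    thus ?case by (simp add: real_germ_def stem_germ_def dom_def)
  qed
qed

text \<open>Identity theorem: the shadow of a slice domain is connected, so a meromorphic stem is
  determined by its values at real points near \<open>r\<close>.\<close>

lemma stem_eqI:
  assumes "mero_stem \<Omega> \<Phi>" "mero_stem \<Omega> \<Psi>"
    and eq: "\<forall>\<^sub>F x in at r. stem_germ \<Phi> x = stem_germ \<Psi> x"
    and e: "e \<in> std_basis" and z: "z \<in> shadow \<Omega>"
    and ana: "\<Phi> e analytic_on {z}" "\<Psi> e analytic_on {z}"
  shows "\<Phi> e z = \<Psi> e z"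
proof -
  define h where "h w = \<Phi> e w - \<Psi> e w" for w
  have mero: "h meromorphic_on shadow \<Omega>"
    unfolding h_def using assms by (intro meromorphic_intros) (auto simp: mero_stem_def)
  have "\<forall>\<^sub>F x in at r. h (of_real x) = 0"
    using eq eventually_real_in_shadow
    by eventually_elim (use assms in \<open>simp add: h_def mero_stem_real\<close>)
  hence "\<not> (\<forall>\<^sub>F x in at r. h (of_real x) \<noteq> 0)"
    using eventually_conj[of _ "at r"] by (force simp: eventually_False dest: eventually_conj)
  hence "\<not> (\<forall>\<^sub>F w in at (of_real r). h w \<noteq> 0)" using eventually_at_real by blast
  hence "\<not> (\<forall>\<^sub>\<approx>w\<in>shadow \<Omega>. h w \<noteq> 0)"
    using eventually_cosparse_imp_eventually_at r_shadow by blast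
  hence "\<forall>\<^sub>\<approx>w\<in>shadow \<Omega>. h w = 0"
    using meromorphic_imp_constant_or_avoid[OF mero open_shadow[OF \<Omega>(1)]
        connected_shadow[OF \<Omega>(2,3) r]] by blast
  hence "\<forall>\<^sub>F w in at z. h w = 0"
    using eventually_cosparse_imp_eventually_at z by blast
  hence "h \<midarrow>z\<rightarrow> 0" by (rule tendsto_eventually)
  moreover have "h \<midarrow>z\<rightarrow> h z"
    unfolding h_def by (intro isContD analytic_at_imp_isCont analytic_intros ana)
  ultimately have "h z = 0" using LIM_unique by blast
  thus ?thesis by (simp add: h_def)
qed

text \<open>Agreement on the common domain is therefore equality of germs.  In particular it is
  transitive, even if the domains shrink.\<close>

lemma agree_iff_real_germ:
  assumes "semi_regular \<Omega> f" "semi_regular \<Omega> g"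
  shows "(\<forall>q\<in>dom f \<inter> dom g. f q = g q) \<longleftrightarrow> (\<forall>\<^sub>F x in at r. real_germ f x = real_germ g x)"
proof -
  note f = semi_regular_imp_stem[OF assms(1) \<Omega>(1,2)]
  note g = semi_regular_imp_stem[OF assms(2) \<Omega>(1,2)]
  note evf = eventually_real_germ[OF f(2,3)] and evg = eventually_real_germ[OF g(2,3)]
  show ?thesis
  proof (intro iffI ballI)
    assume eq: "\<forall>q\<in>dom f \<inter> dom g. f q = g q"
    show "\<forall>\<^sub>F x in at r. real_germ f x = real_germ g x"
      using evf evg by eventually_elim (use eq in \<open>simp add: real_germ_def\<close>)
  next
    fix q assume q: "q \<in> dom f \<inter> dom g" and eq: "\<forall>\<^sub>F x in at r. real_germ f x = real_germ g x"
    define z where "z = height q"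
    have z: "z \<in> shadow (dom f)" "z \<in> shadow (dom g)" "z \<in> shadow \<Omega>"
      using q f(3) g(3) height_in_shadow[of "dom f" q] height_in_shadow[of "dom g" q]
        shadow_mono[of "dom f" \<Omega>] by (auto simp: z_def codiscrete_def)
    have "\<forall>\<^sub>F x in at r. stem_germ (stem (the \<circ> f)) x = stem_germ (stem (the \<circ> g)) x"
      using evf evg eq by eventually_elim simp
    hence "stem (the \<circ> f) e z = stem (the \<circ> g) e z" if "e \<in> std_basis" for e
      using f(2) g(2) z that by (intro stem_eqI[OF f(1) g(1)]) (auto simp: has_stem_def)
    hence "f (emb (axis q) z) = g (emb (axis q) z)"
      using f(2) g(2) z unfolding has_stem_def
      by (simp cong: slice_value_cong)
    thus "f q = g q" by (simp add: z_def emb_axis_height)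
  qed
qed


subsection \<open>The algebra of semi-regular functions embeds into the germs\<close>

abbreviation R where "R \<equiv> SEM \<Omega>"

definition cls :: "(quat \<rightharpoonup> quat) \<Rightarrow> sem" where
  "cls f = sem_rel \<Omega> `` {f}"

lemma sem_rel_iff: "(f, g) \<in> sem_rel \<Omega> \<longleftrightarrow> semi_regular \<Omega> f \<and> semi_regular \<Omega> g \<and>
    (\<forall>\<^sub>F x in at r. real_germ f x = real_germ g x)"
  unfolding sem_rel_def using agree_iff_real_germ by auto

lemma mem_cls_iff: "g \<in> cls f \<longleftrightarrow> semi_regular \<Omega> f \<and> semi_regular \<Omega> g \<and>
    (\<forall>\<^sub>F x in at r. real_germ f x = real_germ g x)"
  by (simp add: cls_def sem_rel_iff)

lemma cls_eqI:
  assumes "semi_regular \<Omega> f" "semi_regular \<Omega> g" "\<forall>\<^sub>F x in at r. real_germ f x = real_germ g x"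
  shows "cls f = cls g"
proof -
  have "(\<forall>\<^sub>F x in at r. real_germ f x = real_germ h x) \<longleftrightarrow>
      (\<forall>\<^sub>F x in at r. real_germ g x = real_germ h x)" for h
    by (rule eventually_subst) (use assms(3) in \<open>eventually_elim, simp\<close>)
  thus ?thesis using assms(1,2) by (auto simp: mem_cls_iff)
qed

lemma carrier_R: "X \<in> carrier R \<longleftrightarrow> (\<exists>f. semi_regular \<Omega> f \<and> X = cls f)"
  by (auto simp: SEM_def quotient_def cls_def)

text \<open>The description of an element by a quaternion-valued function on the real axis near \<open>r\<close>.
  All representatives have the same germ, so one of them suffices to establish it.\<close>

definition has_germ :: "sem \<Rightarrow> (real \<Rightarrow> quat) \<Rightarrow> bool" where
  "has_germ X \<phi> \<longleftrightarrow> X \<in> carrier R \<and> (\<forall>f\<in>X. \<forall>\<^sub>F x in at r. real_germ f x = \<phi> x)"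

lemma has_germ_cls:
  assumes "semi_regular \<Omega> f" "\<forall>\<^sub>F x in at r. real_germ f x = \<phi> x"
  shows "has_germ (cls f) \<phi>"
  using assms by (auto simp: has_germ_def carrier_R mem_cls_iff elim: eventually_elim2)

lemma has_germE:
  assumes "has_germ X \<phi>"
  obtains f where "semi_regular \<Omega> f" "X = cls f" "\<forall>\<^sub>F x in at r. real_germ f x = \<phi> x"
  using assms by (auto simp: has_germ_def carrier_R mem_cls_iff)

lemma has_germ_carrier: "has_germ X \<phi> \<Longrightarrow> X \<in> carrier R"
  by (simp add: has_germ_def)

lemma has_germ_eq_iff:
  assumes "has_germ X \<phi>" "has_germ Y \<psi>"
  shows "X = Y \<longleftrightarrow> (\<forall>\<^sub>F x in at r. \<phi> x = \<psi> x)"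
proof -
  obtain f where f: "semi_regular \<Omega> f" "X = cls f" "\<forall>\<^sub>F x in at r. real_germ f x = \<phi> x"
    using assms(1) by (rule has_germE)
  obtain g where g: "semi_regular \<Omega> g" "Y = cls g" "\<forall>\<^sub>F x in at r. real_germ g x = \<psi> x"
    using assms(2) by (rule has_germE)
  show ?thesis
  proof
    assume "X = Y"
    hence "f \<in> cls g" using f g by (auto simp: mem_cls_iff)
    hence "\<forall>\<^sub>F x in at r. real_germ g x = real_germ f x" by (simp add: mem_cls_iff)
    thus "\<forall>\<^sub>F x in at r. \<phi> x = \<psi> x" using f(3) g(3) by eventually_elim simp
  next
    assume "\<forall>\<^sub>F x in at r. \<phi> x = \<psi> x"
    hence "\<forall>\<^sub>F x in at r. real_germ f x = real_germ g x"
      using f(3) g(3) by eventually_elim simp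
    thus "X = Y" using f g cls_eqI by blast
  qed
qed

lemma has_germ_eqI: "has_germ X \<phi> \<Longrightarrow> has_germ Y \<psi> \<Longrightarrow> (\<And>x. \<phi> x = \<psi> x) \<Longrightarrow> X = Y"
  by (simp add: has_germ_eq_iff)

lemma has_germ_cong:
  "has_germ X \<phi> \<Longrightarrow> \<forall>\<^sub>F x in at r. \<phi> x = \<psi> x \<Longrightarrow> has_germ X \<psi>"
  unfolding has_germ_def by (auto elim: eventually_elim2)

lemma stem_of_element:
  assumes "X \<in> carrier R"
  obtains \<Phi> where "mero_stem \<Omega> \<Phi>" "has_germ X (stem_germ \<Phi>)"
proof -
  obtain f where f: "semi_regular \<Omega> f" "X = cls f" using assms by (auto simp: carrier_R)
  note s = semi_regular_imp_stem[OF f(1) \<Omega>(1,2)]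
  have "has_germ X (stem_germ (stem (the \<circ> f)))"
    unfolding f(2) using eventually_real_germ[OF s(2,3)]
    by (intro has_germ_cls f(1)) (auto elim: eventually_mono)
  thus ?thesis using that s(1) by blast
qed

lemma element_of_stem:
  assumes "mero_stem \<Omega> \<Phi>"
  obtains f where "semi_regular \<Omega> f" "has_stem f \<Phi>" "has_germ (cls f) (stem_germ \<Phi>)"
proof -
  obtain f where f: "semi_regular \<Omega> f" "has_stem f \<Phi>"
    using exists_semi_regular[OF \<Omega>(1,2) assms] .
  have "codiscrete \<Omega> (dom f)" using semi_regular_imp_stem(3)[OF f(1) \<Omega>(1,2)] .
  hence "has_germ (cls f) (stem_germ \<Phi>)"
    using eventually_real_germ[OF f(2)] by (intro has_germ_cls f(1)) (auto elim: eventually_mono)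
  thus ?thesis using that f by blast
qed

lemma has_germ_exists:
  assumes "X \<in> carrier R"
  obtains \<phi> where "has_germ X \<phi>"
  using stem_of_element[OF assms] by blast

lemma UN2_constant:
  assumes "\<And>a b. a \<in> A \<Longrightarrow> b \<in> B \<Longrightarrow> F a b = C" "A \<noteq> {}" "B \<noteq> {}"
  shows "(\<Union>a\<in>A. \<Union>b\<in>B. F a b) = C"
  using assms by auto

text \<open>A pointwise operation on representatives is semi-regular as soon as it has a meromorphic
  stem, for its domain is again codiscrete.\<close>

lemma semi_regular_combine:
  assumes "semi_regular \<Omega> f" "semi_regular \<Omega> g" "dom h = dom f \<inter> dom g"
    and mero: "mero_stem \<Omega> \<Xi>"
    and ana: "\<And>e z. e \<in> std_basis \<Longrightarrow> z \<in> shadow (dom f) \<Longrightarrow> z \<in> shadow (dom g) \<Longrightarrow> \<Xi> e analytic_on {z}"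
    and val: "\<And>I z. I \<in> \<S> \<Longrightarrow> z \<in> shadow (dom f) \<Longrightarrow> z \<in> shadow (dom g) \<Longrightarrow>
      emb I z \<in> dom f \<inter> dom g \<Longrightarrow> h (emb I z) = Some (slice_value I (\<lambda>e. \<Xi> e z))"
  shows "semi_regular \<Omega> h"
proof -
  have D: "circular (dom f)" "circular (dom g)"
    using assms(1,2) by (auto simp: semi_regular_def)
  have "codiscrete \<Omega> (dom h)"
    unfolding assms(3) using semi_regular_imp_stem(3)[OF _ \<Omega>(1,2)] assms(1,2)
    by (intro codiscrete_Int) auto
  moreover have "has_stem h \<Xi>"
    unfolding has_stem_def assms(3) shadow_Int
    using ana val emb_in_circular_iff[OF D(1)] emb_in_circular_iff[OF D(2)] by blast
  ultimately show ?thesis using stem_imp_semi_regular[OF \<Omega>(1,2) mero] by blast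
qed

lemma semi_regular_pplus:
  assumes f: "semi_regular \<Omega> f" and g: "semi_regular \<Omega> g"
  shows "semi_regular \<Omega> (pplus f g)"
proof -
  note sf = semi_regular_imp_stem[OF f \<Omega>(1,2)] and sg = semi_regular_imp_stem[OF g \<Omega>(1,2)]
  let ?\<Phi> = "stem (the \<circ> f)" and ?\<Psi> = "stem (the \<circ> g)"
  show ?thesis
  proof (rule semi_regular_combine[OF f g])
    show "dom (pplus f g) = dom f \<inter> dom g" by (auto simp: pplus_def restrict_map_def split: if_splits)
    show "mero_stem \<Omega> (\<lambda>e z. ?\<Phi> e z + ?\<Psi> e z)"
      using sf(1) sg(1) by (auto simp: mero_stem_def intro!: meromorphic_intros)
    show "(\<lambda>z. ?\<Phi> e z + ?\<Psi> e z) analytic_on {z}"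
      if "e \<in> std_basis" "z \<in> shadow (dom f)" "z \<in> shadow (dom g)" for e z
      using that sf(2) sg(2) by (auto simp: has_stem_def intro!: analytic_intros)
    show "pplus f g (emb I z) = Some (slice_value I (\<lambda>e. ?\<Phi> e z + ?\<Psi> e z))"
      if "I \<in> \<S>" "z \<in> shadow (dom f)" "z \<in> shadow (dom g)" "emb I z \<in> dom f \<inter> dom g" for I z
      using that sf(2) sg(2) by (simp add: pplus_def has_stem_def slice_value_add)
  qed
qed

lemma semi_regular_pstar:
  assumes f: "semi_regular \<Omega> f" and g: "semi_regular \<Omega> g"
  shows "semi_regular \<Omega> (pstar f g)"
proof -
  note sf = semi_regular_imp_stem[OF f \<Omega>(1,2)] and sg = semi_regular_imp_stem[OF g \<Omega>(1,2)]
  let ?\<Phi> = "stem (the \<circ> f)" and ?\<Psi> = "stem (the \<circ> g)"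
  let ?\<Xi> = "\<lambda>e z. stem_mult (\<lambda>a. ?\<Phi> a z) (\<lambda>a. ?\<Psi> a z) e"
  show ?thesis
  proof (rule semi_regular_combine[OF f g])
    show "dom (pstar f g) = dom f \<inter> dom g" by (auto simp: pstar_def restrict_map_def split: if_splits)
    show "mero_stem \<Omega> ?\<Xi>"
      using sf(1) sg(1) unfolding mero_stem_def stem_mult_def
      by (auto intro!: meromorphic_intros)
    show "?\<Xi> e analytic_on {z}"
      if "e \<in> std_basis" "z \<in> shadow (dom f)" "z \<in> shadow (dom g)" for e z
      using that sf(2) sg(2) unfolding has_stem_def stem_mult_def by (auto intro!: analytic_intros)
    show "pstar f g (emb I z) = Some (slice_value I (\<lambda>e. ?\<Xi> e z))"
      if "I \<in> \<S>" "z \<in> shadow (dom f)" "z \<in> shadow (dom g)" "emb I z \<in> dom f \<inter> dom g" for I z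
    proof -
      have "star_prod (the \<circ> f) (the \<circ> g) (emb I z)
          = slice_value I (stem_mult (\<lambda>a. ?\<Phi> a z) (\<lambda>a. ?\<Psi> a z))"
        using that sf(2) sg(2) by (intro star_prod_slice_value) (auto simp: has_stem_def)
      thus ?thesis using that(4) by (simp add: pstar_def)
    qed
  qed
qed

lemma eventually_real_in_dom: "semi_regular \<Omega> f \<Longrightarrow> \<forall>\<^sub>F x in at r. of_real x \<in> dom f"
  using eventually_real_germ[OF semi_regular_imp_stem(2,3)[OF _ \<Omega>(1,2)]]
  unfolding eventually_conj_iff by blast

lemma real_germ_pplus:
  assumes "semi_regular \<Omega> f" "semi_regular \<Omega> g"
  shows "\<forall>\<^sub>F x in at r. real_germ (pplus f g) x = real_germ f x + real_germ g x"
  using eventually_real_in_dom[OF assms(1)] eventually_real_in_dom[OF assms(2)]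
  by eventually_elim (simp add: real_germ_def pplus_def)

text \<open>A real point commutes with every quaternion, hence is its own conjugate: on the real axis
  the star product is the pointwise product.\<close>

lemma real_germ_pstar:
  assumes "semi_regular \<Omega> f" "semi_regular \<Omega> g"
  shows "\<forall>\<^sub>F x in at r. real_germ (pstar f g) x = real_germ f x * real_germ g x"
  using eventually_real_in_dom[OF assms(1)] eventually_real_in_dom[OF assms(2)]
proof eventually_elim
  case (elim x)
  have "inverse q * of_real x * q = of_real x" if "q \<noteq> 0" for q :: quat
    using that by (simp add: mult.assoc of_real_quat_commute) (simp add: mult.assoc[symmetric])
  thus ?case using elim by (simp add: real_germ_def pstar_def star_prod_def)
qed

lemma has_germ_add:
  assumes "has_germ X \<phi>" "has_germ Y \<psi>"
  shows "has_germ (X \<oplus>\<^bsub>R\<^esub> Y) (\<lambda>x. \<phi> x + \<psi> x)"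
proof -
  obtain f where f: "semi_regular \<Omega> f" "X = cls f" "\<forall>\<^sub>F x in at r. real_germ f x = \<phi> x"
    using assms(1) by (rule has_germE)
  obtain g where g: "semi_regular \<Omega> g" "Y = cls g" "\<forall>\<^sub>F x in at r. real_germ g x = \<psi> x"
    using assms(2) by (rule has_germE)
  have *: "cls (pplus f' g') = cls (pplus f g)" if "f' \<in> X" "g' \<in> Y" for f' g'
  proof (rule cls_eqI)
    have *: "semi_regular \<Omega> f'" "semi_regular \<Omega> g'" "\<forall>\<^sub>F x in at r. real_germ f x = real_germ f' x"
      "\<forall>\<^sub>F x in at r. real_germ g x = real_germ g' x"
      using that f g by (auto simp: mem_cls_iff)
    show "semi_regular \<Omega> (pplus f' g')" "semi_regular \<Omega> (pplus f g)"
      using * f g semi_regular_pplus by auto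
    show "\<forall>\<^sub>F x in at r. real_germ (pplus f' g') x = real_germ (pplus f g) x"
      using real_germ_pplus[OF *(1,2)] real_germ_pplus[OF f(1) g(1)] *(3,4)
      by eventually_elim simp
  qed
  have mem: "f \<in> X" "g \<in> Y" using f g by (auto simp: mem_cls_iff)
  have "X \<oplus>\<^bsub>R\<^esub> Y = (\<Union>f'\<in>X. \<Union>g'\<in>Y. cls (pplus f' g'))"
    by (simp add: SEM_def cls_def)
  also have "\<dots> = cls (pplus f g)"
    by (rule UN2_constant) (rule *, assumption+, use mem in auto)
  finally have eq: "X \<oplus>\<^bsub>R\<^esub> Y = cls (pplus f g)" .
  have "\<forall>\<^sub>F x in at r. real_germ (pplus f g) x = \<phi> x + \<psi> x"
    using real_germ_pplus[OF f(1) g(1)] f(3) g(3) by eventually_elim simp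
  thus ?thesis unfolding eq using f g by (intro has_germ_cls semi_regular_pplus)
qed

lemma has_germ_mult:
  assumes "has_germ X \<phi>" "has_germ Y \<psi>"
  shows "has_germ (X \<otimes>\<^bsub>R\<^esub> Y) (\<lambda>x. \<phi> x * \<psi> x)"
proof -
  obtain f where f: "semi_regular \<Omega> f" "X = cls f" "\<forall>\<^sub>F x in at r. real_germ f x = \<phi> x"
    using assms(1) by (rule has_germE)
  obtain g where g: "semi_regular \<Omega> g" "Y = cls g" "\<forall>\<^sub>F x in at r. real_germ g x = \<psi> x"
    using assms(2) by (rule has_germE)
  have *: "cls (pstar f' g') = cls (pstar f g)" if "f' \<in> X" "g' \<in> Y" for f' g'
  proof (rule cls_eqI)
    have *: "semi_regular \<Omega> f'" "semi_regular \<Omega> g'" "\<forall>\<^sub>F x in at r. real_germ f x = real_germ f' x"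
      "\<forall>\<^sub>F x in at r. real_germ g x = real_germ g' x"
      using that f g by (auto simp: mem_cls_iff)
    show "semi_regular \<Omega> (pstar f' g')" "semi_regular \<Omega> (pstar f g)"
      using * f g semi_regular_pstar by auto
    show "\<forall>\<^sub>F x in at r. real_germ (pstar f' g') x = real_germ (pstar f g) x"
      using real_germ_pstar[OF *(1,2)] real_germ_pstar[OF f(1) g(1)] *(3,4)
      by eventually_elim simp
  qed
  have mem: "f \<in> X" "g \<in> Y" using f g by (auto simp: mem_cls_iff)
  have "X \<otimes>\<^bsub>R\<^esub> Y = (\<Union>f'\<in>X. \<Union>g'\<in>Y. cls (pstar f' g'))"
    by (simp add: SEM_def cls_def)
  also have "\<dots> = cls (pstar f g)"
    by (rule UN2_constant) (rule *, assumption+, use mem in auto)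
  finally have eq: "X \<otimes>\<^bsub>R\<^esub> Y = cls (pstar f g)" .
  have "\<forall>\<^sub>F x in at r. real_germ (pstar f g) x = \<phi> x * \<psi> x"
    using real_germ_pstar[OF f(1) g(1)] f(3) g(3) by eventually_elim simp
  thus ?thesis unfolding eq using f g by (intro has_germ_cls semi_regular_pstar)
qed

lemma has_germ_const: "has_germ (sem_const \<Omega> c) (\<lambda>_. c)"
proof -
  let ?f = "(\<lambda>_. Some c) |` \<Omega>" and ?\<Phi> = "\<lambda>e (z :: complex). complex_of_real (inner e c)"
  have dom: "dom ?f = \<Omega>" by (auto simp: restrict_map_def split: if_splits)
  have "has_stem ?f ?\<Phi>"
    unfolding has_stem_def dom using emb_in_circular_iff[OF \<Omega>(2)] by simp
  moreover have "mero_stem \<Omega> ?\<Phi>" by (simp add: mero_stem_def meromorphic_on_const)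
  moreover have "codiscrete \<Omega> (dom ?f)"
    unfolding codiscrete_def dom using \<Omega> eventually_at_in_open'[OF open_shadow[OF \<Omega>(1)]] by blast
  ultimately have semi: "semi_regular \<Omega> ?f"
    using stem_imp_semi_regular[OF \<Omega>(1,2)] by blast
  have "\<forall>\<^sub>F x in at r. real_germ ?f x = c"
    using eventually_real_in_dom[OF semi] unfolding dom by eventually_elim (simp add: real_germ_def)
  thus ?thesis
    unfolding sem_const_def using has_germ_cls[OF semi] by (simp add: cls_def)
qed

lemma has_germ_one: "has_germ \<one>\<^bsub>R\<^esub> (\<lambda>_. 1)" and has_germ_zero: "has_germ \<zero>\<^bsub>R\<^esub> (\<lambda>_. 0)"
  using has_germ_const by (simp_all add: SEM_def)

end

context slice_domain_at
begin

lemma ring_R: "ring R"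
proof (intro ringI abelian_groupI monoidI)
  fix X Y Z assume "X \<in> carrier R" "Y \<in> carrier R" "Z \<in> carrier R"
  then obtain \<phi> \<psi> \<theta> where g: "has_germ X \<phi>" "has_germ Y \<psi>" "has_germ Z \<theta>"
    using has_germ_exists by metis
  note i = has_germ_add has_germ_mult g
  show "X \<oplus>\<^bsub>R\<^esub> Y \<oplus>\<^bsub>R\<^esub> Z = X \<oplus>\<^bsub>R\<^esub> (Y \<oplus>\<^bsub>R\<^esub> Z)"
    by (rule has_germ_eqI, (rule i)+) (simp add: add.assoc)
  show "X \<otimes>\<^bsub>R\<^esub> Y \<otimes>\<^bsub>R\<^esub> Z = X \<otimes>\<^bsub>R\<^esub> (Y \<otimes>\<^bsub>R\<^esub> Z)"
    by (rule has_germ_eqI, (rule i)+) (simp add: mult.assoc)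
  show "(X \<oplus>\<^bsub>R\<^esub> Y) \<otimes>\<^bsub>R\<^esub> Z = X \<otimes>\<^bsub>R\<^esub> Z \<oplus>\<^bsub>R\<^esub> Y \<otimes>\<^bsub>R\<^esub> Z"
    by (rule has_germ_eqI, (rule i)+) (simp add: distrib_right)
  show "Z \<otimes>\<^bsub>R\<^esub> (X \<oplus>\<^bsub>R\<^esub> Y) = Z \<otimes>\<^bsub>R\<^esub> X \<oplus>\<^bsub>R\<^esub> Z \<otimes>\<^bsub>R\<^esub> Y"
    by (rule has_germ_eqI, (rule i)+) (simp add: distrib_left)
next
  fix X Y assume "X \<in> carrier R" "Y \<in> carrier R"
  then obtain \<phi> \<psi> where g: "has_germ X \<phi>" "has_germ Y \<psi>"
    using has_germ_exists by metis
  show "X \<oplus>\<^bsub>R\<^esub> Y \<in> carrier R" "X \<otimes>\<^bsub>R\<^esub> Y \<in> carrier R"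
    using has_germ_add[OF g] has_germ_mult[OF g] has_germ_carrier by blast+
  show "X \<oplus>\<^bsub>R\<^esub> Y = Y \<oplus>\<^bsub>R\<^esub> X"
    by (rule has_germ_eqI, (rule has_germ_add g)+) (simp add: add.commute)
next
  fix X assume "X \<in> carrier R"
  then obtain \<phi> where g: "has_germ X \<phi>" using has_germ_exists by metis
  show "\<zero>\<^bsub>R\<^esub> \<oplus>\<^bsub>R\<^esub> X = X"
    by (rule has_germ_eqI[OF has_germ_add[OF has_germ_zero g] g]) simp
  show "\<one>\<^bsub>R\<^esub> \<otimes>\<^bsub>R\<^esub> X = X"
    by (rule has_germ_eqI[OF has_germ_mult[OF has_germ_one g] g]) simp
  show "X \<otimes>\<^bsub>R\<^esub> \<one>\<^bsub>R\<^esub> = X"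
    by (rule has_germ_eqI[OF has_germ_mult[OF g has_germ_one] g]) simp
  have n: "has_germ (sem_const \<Omega> (- 1) \<otimes>\<^bsub>R\<^esub> X) (\<lambda>x. (- 1) * \<phi> x)"
    by (rule has_germ_mult[OF has_germ_const g])
  have "sem_const \<Omega> (- 1) \<otimes>\<^bsub>R\<^esub> X \<oplus>\<^bsub>R\<^esub> X = \<zero>\<^bsub>R\<^esub>"
    by (rule has_germ_eqI[OF has_germ_add[OF n g] has_germ_zero]) simp
  thus "\<exists>Y\<in>carrier R. Y \<oplus>\<^bsub>R\<^esub> X = \<zero>\<^bsub>R\<^esub>" using has_germ_carrier[OF n] by blast
qed (use has_germ_zero has_germ_one has_germ_carrier in blast)+

sublocale ring R by (rule ring_R)

lemma has_germ_a_inv: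
  assumes "has_germ X \<phi>"
  shows "has_germ (\<ominus>\<^bsub>R\<^esub> X) (\<lambda>x. - \<phi> x)"
proof -
  have n: "has_germ (sem_const \<Omega> (- 1) \<otimes>\<^bsub>R\<^esub> X) (\<lambda>x. (- 1) * \<phi> x)"
    by (rule has_germ_mult[OF has_germ_const assms])
  have "sem_const \<Omega> (- 1) \<otimes>\<^bsub>R\<^esub> X \<oplus>\<^bsub>R\<^esub> X = \<zero>\<^bsub>R\<^esub>"
    by (rule has_germ_eqI[OF has_germ_add[OF n assms] has_germ_zero]) simp
  hence "\<ominus>\<^bsub>R\<^esub> X = sem_const \<Omega> (- 1) \<otimes>\<^bsub>R\<^esub> X"
    using minus_equality has_germ_carrier[OF n] has_germ_carrier[OF assms] by blast
  thus ?thesis using n by simp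
qed

lemma has_germ_minus:
  assumes "has_germ X \<phi>" "has_germ Y \<psi>"
  shows "has_germ (X \<ominus>\<^bsub>R\<^esub> Y) (\<lambda>x. \<phi> x - \<psi> x)"
  using has_germ_add[OF assms(1) has_germ_a_inv[OF assms(2)]] by (simp add: a_minus_def)

text \<open>The inverse of a stem \<open>\<Phi>\<close> is its conjugate divided by the sum of the squares of its
  components; at real points this is the quaternionic inverse, where both conventions for
  division by zero agree.\<close>

lemma has_germ_inverse:
  assumes "has_germ X \<phi>"
  obtains Y where "has_germ Y (\<lambda>x. inverse (\<phi> x))"
proof -
  obtain \<Phi> where \<Phi>: "mero_stem \<Omega> \<Phi>" "has_germ X (stem_germ \<Phi>)"
    using stem_of_element[OF has_germ_carrier[OF assms]] .
  define \<Psi> where "\<Psi> e z = (if e = 1 then \<Phi> e z else - \<Phi> e z) / (\<Sum>a\<in>std_basis. \<Phi> a z * \<Phi> a z)" for e z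
  have "(\<lambda>z. if e = 1 then \<Phi> e z else - \<Phi> e z) meromorphic_on shadow \<Omega>" if "e \<in> std_basis" for e
    using \<Phi>(1) that by (cases "e = 1") (auto simp: mero_stem_def intro!: meromorphic_intros)
  hence "mero_stem \<Omega> \<Psi>"
    using \<Phi>(1) unfolding mero_stem_def \<Psi>_def
    by (auto intro!: meromorphic_intros)
  then obtain f where f: "has_germ (cls f) (stem_germ \<Psi>)" using element_of_stem by blast
  have "\<forall>\<^sub>F x in at r. stem_germ \<Phi> x = \<phi> x"
    using has_germ_eq_iff[OF \<Phi>(2) assms] by blast
  hence "\<forall>\<^sub>F x in at r. stem_germ \<Psi> x = inverse (\<phi> x)"
    using eventually_real_in_shadow
  proof eventually_elim
    case (elim x)
    define q where "q = \<phi> x"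
    have val: "\<Phi> e (of_real x) = of_real (inner e q)" if "e \<in> std_basis" for e
      using mero_stem_real[OF \<Phi>(1) that elim(2)] elim(1) by (simp add: q_def)
    have "(\<Sum>a\<in>std_basis. \<Phi> a (of_real x) * \<Phi> a (of_real x))
        = (\<Sum>a\<in>std_basis. of_real (inner a q * inner a q))"
      by (rule sum.cong) (simp_all add: val)
    also have "\<dots> = of_real (\<Sum>a\<in>std_basis. inner a q * inner a q)" by simp
    also have "(\<Sum>a\<in>std_basis. inner a q * inner a q) = (norm q)\<^sup>2"
      unfolding norm_quat_squared by (simp add: sum_std_basis inner_quat_def power2_eq_square)
    finally have N: "(\<Sum>a\<in>std_basis. \<Phi> a (of_real x) * \<Phi> a (of_real x)) = of_real ((norm q)\<^sup>2)" .
    have "inner e (inverse q) = (if e = 1 then inner e q else - inner e q) / (norm q)\<^sup>2"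
      if "e \<in> std_basis" for e
      using that by (auto simp: std_basis_def inner_quat_def inverse_quat_def divide_inverse quat_eq_iff)
    hence "\<Psi> e (of_real x) = of_real (inner e (inverse q))" if "e \<in> std_basis" for e
      unfolding \<Psi>_def N using that val[OF that] by (cases "e = 1") auto
    hence "stem_germ \<Psi> x = slice_value ref_unit (\<lambda>e. of_real (inner e (inverse q)))"
      unfolding stem_germ_def by (rule slice_value_cong)
    thus ?case by (simp add: q_def)
  qed
  from has_germ_cong[OF f this] show ?thesis by (rule that)
qed

text \<open>A coefficient of the stem that is not identically zero has isolated zeros, and at real points
  the other coefficients cannot cancel it, since they are real coordinates of the value.\<close>

lemma nonzero_element:
  assumes X: "has_germ X \<phi>" and nz: "X \<noteq> \<zero>\<^bsub>R\<^esub>"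
  shows "\<forall>\<^sub>F x in at r. \<phi> x \<noteq> 0"
proof -
  obtain \<Phi> where \<Phi>: "mero_stem \<Omega> \<Phi>" "has_germ X (stem_germ \<Phi>)"
    using stem_of_element[OF has_germ_carrier[OF X]] .
  have eq: "\<forall>\<^sub>F x in at r. stem_germ \<Phi> x = \<phi> x"
    using has_germ_eq_iff[OF \<Phi>(2) X] by blast
  have dich: "(\<forall>\<^sub>F w in at (of_real r). \<Phi> e w = 0) \<or> (\<forall>\<^sub>F w in at (of_real r). \<Phi> e w \<noteq> 0)"
    if "e \<in> std_basis" for e
    using meromorphic_imp_constant_or_avoid[OF _ open_shadow[OF \<Omega>(1)] connected_shadow[OF \<Omega>(2,3) r], of "\<Phi> e" 0]
      \<Phi>(1) that eventually_cosparse_imp_eventually_at[OF _ r_shadow]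
    unfolding mero_stem_def by blast
  have "\<not> (\<forall>e\<in>std_basis. \<forall>\<^sub>F w in at (of_real r). \<Phi> e w = 0)"
  proof
    assume "\<forall>e\<in>std_basis. \<forall>\<^sub>F w in at (of_real r). \<Phi> e w = 0"
    hence "\<forall>\<^sub>F w in at (of_real r). \<forall>e\<in>std_basis. \<Phi> e w = 0"
      by (simp add: eventually_ball_finite)
    hence "\<forall>\<^sub>F x in at r. \<forall>e\<in>std_basis. \<Phi> e (of_real x) = 0" by (rule eventually_at_real)
    hence "\<forall>\<^sub>F x in at r. stem_germ \<Phi> x = 0"
      by eventually_elim (simp add: stem_germ_def slice_value_def)
    thus False using nz has_germ_eq_iff[OF \<Phi>(2) has_germ_zero] by blast
  qed
  then obtain e where e: "e \<in> std_basis" "\<forall>\<^sub>F w in at (of_real r). \<Phi> e w \<noteq> 0"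
    using dich by blast
  show ?thesis
    using eventually_at_real[OF e(2)] eventually_real_in_shadow eq
  proof eventually_elim
    case (elim x)
    thus ?case using mero_stem_real[OF \<Phi>(1) e(1), of x] by auto
  qed
qed

lemma nonzero_unit:
  assumes X: "X \<in> carrier R" and nz: "X \<noteq> \<zero>\<^bsub>R\<^esub>"
  shows "X \<in> Units R"
proof -
  obtain \<phi> where \<phi>: "has_germ X \<phi>" using has_germ_exists[OF X] .
  obtain Y where Y: "has_germ Y (\<lambda>x. inverse (\<phi> x))" using has_germ_inverse[OF \<phi>] .
  have nz: "\<forall>\<^sub>F x in at r. \<phi> x \<noteq> 0" by (rule nonzero_element[OF \<phi> nz])
  have "X \<otimes>\<^bsub>R\<^esub> Y = \<one>\<^bsub>R\<^esub>" "Y \<otimes>\<^bsub>R\<^esub> X = \<one>\<^bsub>R\<^esub>"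
    using nz by (auto simp: has_germ_eq_iff[OF has_germ_mult[OF \<phi> Y] has_germ_one]
        has_germ_eq_iff[OF has_germ_mult[OF Y \<phi>] has_germ_one] elim: eventually_mono)
  thus ?thesis using X has_germ_carrier[OF Y] by (auto simp: Units_def)
qed


subsection \<open>Slice preserving elements and components\<close>

text \<open>The value at a real point lies in all slices, and two slices of independent units meet in the
  real numbers.\<close>

lemma SEM\<^sub>R_germ:
  assumes "a \<in> SEM\<^sub>R \<Omega>"
  obtains t where "has_germ a (\<lambda>x. of_real (t x))"
proof -
  obtain f where f: "semi_regular \<Omega> f" "slice_preserving f" "a = cls f"
    using assms by (auto simp: SEM\<^sub>R_def cls_def)
  have "\<forall>\<^sub>F x in at r. real_germ f x = of_real (qre (real_germ f x))"
    using eventually_real_in_dom[OF f(1)]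
  proof eventually_elim
    case (elim x)
    have slice: "of_real x \<in> cplane I" for I
      unfolding cplane_def by (rule CollectI, rule exI[of _ x], rule exI[of _ 0]) simp
    let ?j = "Quat 0 0 1 0"
    have j: "?j \<in> \<S>" by (simp add: imag_units_iff)
    have "the (f (of_real x)) \<in> cplane I" if "I \<in> \<S>" for I
      using f(2) elim slice that unfolding slice_preserving_def by (auto simp: image_subset_iff)
    from this[OF ref_unit_imag_unit] this[OF j] show ?case
      by (auto simp: real_germ_def cplane_def quat_eq_iff quat_sel_times ref_unit_def)
  qed
  hence "has_germ a (\<lambda>x. of_real (qre (real_germ f x)))"
    unfolding f(3) by (rule has_germ_cls[OF f(1)])
  thus ?thesis by (rule that)
qed

lemma emb_in_cplane: "emb I z \<in> cplane I"
  by (auto simp: cplane_def emb_def)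

text \<open>The stem has all its weight on the basis element \<open>1\<close>, which makes the function slice
  preserving.\<close>

lemma coordinate_exists:
  assumes "has_germ X \<phi>"
  obtains Y where "Y \<in> SEM\<^sub>R \<Omega>" "has_germ Y (\<lambda>x. of_real (inner v (\<phi> x)))"
proof -
  obtain \<Phi> where \<Phi>: "mero_stem \<Omega> \<Phi>" "has_germ X (stem_germ \<Phi>)"
    using stem_of_element[OF has_germ_carrier[OF assms]] .
  define \<Psi> where "\<Psi> e z = of_real (inner e 1) * (\<Sum>a\<in>std_basis. of_real (inner v a) * \<Phi> a z)"
    for e :: quat and z
  have "mero_stem \<Omega> \<Psi>"
    using \<Phi>(1) unfolding mero_stem_def \<Psi>_def
    by (auto intro!: meromorphic_intros meromorphic_on_const)
  then obtain f where f: "semi_regular \<Omega> f" "has_stem f \<Psi>" "has_germ (cls f) (stem_germ \<Psi>)"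
    using element_of_stem by blast
  have val: "slice_value I (\<lambda>e. \<Psi> e z) = emb I (\<Sum>a\<in>std_basis. of_real (inner v a) * \<Phi> a z)"
    if "I \<in> \<S>" for I z
    using slice_value_mult[OF that, of "\<Sum>a\<in>std_basis. of_real (inner v a) * \<Phi> a z" "\<lambda>e. of_real (inner e 1)"]
    by (simp add: \<Psi>_def mult.commute)
  have "slice_preserving f"
    unfolding slice_preserving_def
  proof (intro ballI subsetI)
    fix I q assume I: "I \<in> \<S>" and "q \<in> (the \<circ> f) ` (dom f \<inter> cplane I)"
    then obtain x y where xy: "emb I (Complex x y) \<in> dom f" "q = the (f (emb I (Complex x y)))"
      by (auto simp: cplane_def)
    hence "q = slice_value I (\<lambda>e. \<Psi> e (Complex x y))"
      using f(1,2) I emb_in_circular_iff[OF _ I, of "dom f"]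
      by (auto simp: has_stem_def semi_regular_def simp del: emb_Complex)
    thus "q \<in> cplane I" unfolding val[OF I] by (simp only: emb_in_cplane)
  qed
  hence "cls f \<in> SEM\<^sub>R \<Omega>" using f(1) by (auto simp: SEM\<^sub>R_def cls_def)
  moreover have "\<forall>\<^sub>F x in at r. stem_germ \<Phi> x = \<phi> x"
    using has_germ_eq_iff[OF \<Phi>(2) assms] by blast
  hence "\<forall>\<^sub>F x in at r. stem_germ \<Psi> x = of_real (inner v (\<phi> x))"
    using eventually_real_in_shadow
  proof eventually_elim
    case (elim x)
    have "(\<Sum>a\<in>std_basis. of_real (inner v a) * \<Phi> a (of_real x))
        = (\<Sum>a\<in>std_basis. complex_of_real (inner v a * inner a (\<phi> x)))"
      using mero_stem_real[OF \<Phi>(1) _ elim(2)] elim(1) by (intro sum.cong) simp_all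
    also have "\<dots> = of_real (inner v (\<phi> x))"
      by (simp add: sum_std_basis inner_quat_def)
    finally show ?case
      using val[OF ref_unit_imag_unit] by (simp add: stem_germ_def)
  qed
  ultimately show ?thesis by (intro that[of "cls f"] has_germ_cong[OF f(3)])
qed

end

subsection \<open>Orthonormal bases\<close>

lemma imaginary_anticommute:
  assumes "qre a = 0" "qre b = 0" "inner a b = 0"
  shows "a * b = - (b * a)"
  using assms by (simp add: quat_eq_iff quat_sel_times inner_quat_def)

lemma imaginary_commute_parallel:
  assumes "qre v = 0" "W \<in> \<S>" "v * W = W * v"
  obtains t where "v = t *\<^sub>R W"
proof -
  have "v * W = of_real (qre (v * W))"
    using assms by (simp add: quat_eq_iff quat_sel_times imag_units_iff algebra_simps)
  hence "v * W * W = of_real (qre (v * W)) * W" by simp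
  hence "- v = qre (v * W) *\<^sub>R W"
    by (simp add: mult.assoc imag_units_square[OF assms(2)] scaleR_conv_of_real)
  hence "v = (- qre (v * W)) *\<^sub>R W" by (metis minus_minus scaleR_minus_left)
  thus ?thesis by (rule that)
qed

text \<open>An imaginary quaternion orthogonal to \<open>I\<close> and \<open>J\<close> anticommutes with both, hence commutes
  with \<open>I J\<close> and is a real multiple of it.  This applies to \<open>K\<close>, and to the part of \<open>q\<close> that is
  orthogonal to the basis.\<close>

lemma orthonormal_expansion:
  assumes "orthonormal_basis I J K"
  shows "q = of_real (qre q) + (of_real (inner I q) * I + of_real (inner J q) * J
    + of_real (inner K q) * K)"
proof -
  have norm: "norm I = 1" "norm J = 1" "norm K = 1"
    and orth: "inner I J = 0" "inner I K = 0" "inner J K = 0"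
      "inner J I = 0" "inner K I = 0" "inner K J = 0"
    and re: "qre I = 0" "qre J = 0" "qre K = 0"
    using assms by (auto simp: orthonormal_basis_def inner_commute) (auto simp: inner_quat_def)
  define W where "W = I * J"
  have unit: "I \<in> \<S>" "J \<in> \<S>"
    using norm norm_quat_squared[of I] norm_quat_squared[of J] re by (auto simp: imag_units_iff)
  have "W * W = I * (J * I) * J" by (simp add: W_def mult.assoc)
  also have "J * I = - (I * J)" by (rule imaginary_anticommute[OF re(2,1) orth(4)])
  finally have "W * W = - (I * I * (J * J))" by (simp add: mult.assoc)
  hence W: "W \<in> \<S>"
    using unit by (simp add: imag_units_square) (simp add: imag_units_def power2_eq_square)
  have par: "\<exists>t. v = t *\<^sub>R W" if v: "qre v = 0" "inner v I = 0" "inner v J = 0" for v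
  proof -
    have "v * W = (v * I) * J" by (simp add: W_def mult.assoc)
    also have "v * I = - (I * v)" by (rule imaginary_anticommute[OF v(1) re(1) v(2)])
    also have "- (I * v) * J = - (I * (v * J))" by (simp add: mult.assoc)
    also have "v * J = - (J * v)" by (rule imaginary_anticommute[OF v(1) re(2) v(3)])
    finally have "v * W = W * v" by (simp add: W_def mult.assoc)
    thus ?thesis using imaginary_commute_parallel[OF v(1) W] by blast
  qed
  define v where "v = q - of_real (qre q) - inner I q *\<^sub>R I - inner J q *\<^sub>R J - inner K q *\<^sub>R K"
  have sq: "inner I I = 1" "inner J J = 1" "inner K K = 1"
    using norm by (simp_all flip: power2_norm_eq_inner)
  have im: "inner (of_real x) I = 0" "inner (of_real x) J = 0" "inner (of_real x) K = 0" for x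
    using re by (simp_all add: inner_quat_def)
  have v: "qre v = 0" "inner v I = 0" "inner v J = 0" "inner v K = 0"
    using re by (simp_all add: v_def inner_diff_left im sq orth
        inner_commute[of q I] inner_commute[of q J] inner_commute[of q K])
  obtain s where s: "v = s *\<^sub>R W" using par[OF v(1-3)] by blast
  obtain t where t: "K = t *\<^sub>R W" using par[OF re(3) orth(5,6)] by blast
  have "inner W W = 1" using W by (simp add: imag_units_iff inner_quat_def power2_eq_square)
  hence "s * t = 0" using v(4) by (auto simp: s t)
  moreover have "t \<noteq> 0" using t norm(3) by auto
  ultimately have "v = 0" by (simp add: s)
  thus ?thesis by (simp add: v_def scaleR_conv_of_real algebra_simps)
qed

subsection \<open>Real part and symmetrization of an element\<close>

definition qconj :: "quat \<Rightarrow> quat" where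
  "qconj q = (2 * qre q) *\<^sub>R 1 - q"

lemma quat_times_qconj: "q * qconj q = (norm q)\<^sup>2 *\<^sub>R 1"
  unfolding norm_quat_squared
  by (simp add: quat_eq_iff quat_sel_times qconj_def power2_eq_square algebra_simps)

context slice_domain_at
begin

lemma has_germ_vec_part:
  assumes "has_germ X1 \<phi>1" "has_germ X2 \<phi>2" "has_germ X3 \<phi>3"
  shows "has_germ (vec_part \<Omega> (I, J, K) X1 X2 X3) (\<lambda>x. \<phi>1 x * I + \<phi>2 x * J + \<phi>3 x * K)"
  unfolding vec_part_def prod.case
  by (intro has_germ_add has_germ_mult assms has_germ_const)

context
  fixes I J K :: quat
  assumes onb: "orthonormal_basis I J K"
begin

text \<open>The components have real values at real points, so the imaginary basis elements do not
  contribute to the real part.\<close>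

lemma components_germ:
  assumes X: "has_germ X \<phi>" and comp: "components \<Omega> (I, J, K) X X0 X1 X2 X3"
  shows "has_germ X0 (\<lambda>x. of_real (qre (\<phi> x)))"
    "has_germ (X0 \<ominus>\<^bsub>R\<^esub> vec_part \<Omega> (I, J, K) X1 X2 X3) (\<lambda>x. qconj (\<phi> x))"
proof -
  have mem: "X0 \<in> SEM\<^sub>R \<Omega>" "X1 \<in> SEM\<^sub>R \<Omega>" "X2 \<in> SEM\<^sub>R \<Omega>" "X3 \<in> SEM\<^sub>R \<Omega>"
    and eq: "X = X0 \<oplus>\<^bsub>R\<^esub> vec_part \<Omega> (I, J, K) X1 X2 X3"
    using comp by (auto simp: components_def)
  obtain t0 where t0: "has_germ X0 (\<lambda>x. of_real (t0 x))" using SEM\<^sub>R_germ[OF mem(1)] .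
  obtain t1 where t1: "has_germ X1 (\<lambda>x. of_real (t1 x))" using SEM\<^sub>R_germ[OF mem(2)] .
  obtain t2 where t2: "has_germ X2 (\<lambda>x. of_real (t2 x))" using SEM\<^sub>R_germ[OF mem(3)] .
  obtain t3 where t3: "has_germ X3 (\<lambda>x. of_real (t3 x))" using SEM\<^sub>R_germ[OF mem(4)] .
  have im: "qre I = 0" "qre J = 0" "qre K = 0"
    using onb by (auto simp: orthonormal_basis_def inner_quat_def)
  note V = has_germ_vec_part[OF t1 t2 t3, of I J K]
  have "\<forall>\<^sub>F x in at r. \<phi> x = of_real (t0 x) + (of_real (t1 x) * I + of_real (t2 x) * J + of_real (t3 x) * K)"
    using has_germ_eq_iff[OF X has_germ_add[OF t0 V]] eq by blast
  hence ev: "\<forall>\<^sub>F x in at r. of_real (t0 x) = (of_real (qre (\<phi> x)) :: quat) \<and>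
      of_real (t0 x) - (of_real (t1 x) * I + of_real (t2 x) * J + of_real (t3 x) * K) = qconj (\<phi> x)"
    by eventually_elim (simp add: im quat_sel_times qconj_def quat_eq_iff)
  show "has_germ X0 (\<lambda>x. of_real (qre (\<phi> x)))"
    by (rule has_germ_cong[OF t0]) (use ev in \<open>simp add: eventually_conj_iff\<close>)
  show "has_germ (X0 \<ominus>\<^bsub>R\<^esub> vec_part \<Omega> (I, J, K) X1 X2 X3) (\<lambda>x. qconj (\<phi> x))"
    by (rule has_germ_cong[OF has_germ_minus[OF t0 V]]) (use ev in \<open>simp add: eventually_conj_iff\<close>)
qed

lemma components_exist:
  assumes X: "has_germ X \<phi>"
  obtains X0 X1 X2 X3 where "components \<Omega> (I, J, K) X X0 X1 X2 X3"
proof -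
  obtain X0 where X0: "X0 \<in> SEM\<^sub>R \<Omega>" "has_germ X0 (\<lambda>x. of_real (inner 1 (\<phi> x)))"
    using coordinate_exists[OF X] .
  obtain X1 where X1: "X1 \<in> SEM\<^sub>R \<Omega>" "has_germ X1 (\<lambda>x. of_real (inner I (\<phi> x)))"
    using coordinate_exists[OF X] .
  obtain X2 where X2: "X2 \<in> SEM\<^sub>R \<Omega>" "has_germ X2 (\<lambda>x. of_real (inner J (\<phi> x)))"
    using coordinate_exists[OF X] .
  obtain X3 where X3: "X3 \<in> SEM\<^sub>R \<Omega>" "has_germ X3 (\<lambda>x. of_real (inner K (\<phi> x)))"
    using coordinate_exists[OF X] .
  have re: "inner 1 q = qre q" for q by (simp add: inner_quat_def)
  have "X = X0 \<oplus>\<^bsub>R\<^esub> vec_part \<Omega> (I, J, K) X1 X2 X3"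
    by (rule has_germ_eqI[OF X has_germ_add[OF X0(2) has_germ_vec_part[OF X1(2) X2(2) X3(2)]]])
      (unfold re, rule orthonormal_expansion[OF onb])
  hence "components \<Omega> (I, J, K) X X0 X1 X2 X3"
    using X0 X1 X2 X3 by (simp add: components_def)
  thus ?thesis by (rule that)
qed

lemma has_germ_real_part:
  assumes X: "has_germ X \<phi>"
  shows "has_germ (real_part \<Omega> (I, J, K) X) (\<lambda>x. of_real (qre (\<phi> x)))"
proof -
  obtain X0 X1 X2 X3 where c: "components \<Omega> (I, J, K) X X0 X1 X2 X3"
    using components_exist[OF X] .
  have "real_part \<Omega> (I, J, K) X = X0"
    unfolding real_part_def
  proof (rule the_equality)
    fix Y assume "\<exists>f1 f2 f3. components \<Omega> (I, J, K) X Y f1 f2 f3"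
    thus "Y = X0" using has_germ_eqI components_germ(1)[OF X] c by blast
  qed (use c in blast)
  thus ?thesis using components_germ(1)[OF X c] by simp
qed

lemma has_germ_symmetrization:
  assumes X: "has_germ X \<phi>"
  shows "has_germ (symmetrization \<Omega> (I, J, K) X) (\<lambda>x. (norm (\<phi> x))\<^sup>2 *\<^sub>R 1)"
proof -
  obtain X0 X1 X2 X3 where c: "components \<Omega> (I, J, K) X X0 X1 X2 X3"
    using components_exist[OF X] .
  have "conjugate \<Omega> (I, J, K) X = X0 \<ominus>\<^bsub>R\<^esub> vec_part \<Omega> (I, J, K) X1 X2 X3"
    unfolding conjugate_def
  proof (rule the_equality)
    fix Y assume "\<exists>f0 f1 f2 f3. components \<Omega> (I, J, K) X f0 f1 f2 f3 \<and>
      Y = f0 \<ominus>\<^bsub>R\<^esub> vec_part \<Omega> (I, J, K) f1 f2 f3"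
    thus "Y = X0 \<ominus>\<^bsub>R\<^esub> vec_part \<Omega> (I, J, K) X1 X2 X3"
      using has_germ_eqI components_germ(2)[OF X] c by blast
  qed (use c in blast)
  hence "has_germ (conjugate \<Omega> (I, J, K) X) (\<lambda>x. qconj (\<phi> x))"
    using components_germ(2)[OF X c] by simp
  from has_germ_mult[OF X this] show ?thesis
    by (simp add: symmetrization_def quat_times_qconj)
qed

end

end


section \<open>Sylvester operators\<close>

lemma qre_mult_commute: "qre (a * b) = qre (b * a)"
  by (simp add: quat_sel_times algebra_simps)

text \<open>The value at \<open>a\<close> of the real quadratic polynomial annihilating \<open>b\<close>, namely
  \<open>a\<^sup>2 - 2 Re b a + \<bar>b\<bar>\<^sup>2\<close>, reduced by the quadratic equation of \<open>a\<close>.\<close>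

definition sylvester_disc :: "quat \<Rightarrow> quat \<Rightarrow> quat" where
  "sylvester_disc a b = (2 * (qre a - qre b)) *\<^sub>R a + ((norm b)\<^sup>2 - (norm a)\<^sup>2) *\<^sub>R 1"

text \<open>With \<open>L\<close> and \<open>M\<close> the multiplications by \<open>a\<close> from the left and by \<open>b\<close> from the right, this is
  the operator \<open>L + M - 2 Re b\<close>, the quotient of \<open>L\<^sup>2 - 2 Re b L - (M\<^sup>2 - 2 Re b M)\<close> by \<open>L - M\<close>.\<close>

definition sylvester_cofactor :: "quat \<Rightarrow> quat \<Rightarrow> quat \<Rightarrow> quat" where
  "sylvester_cofactor a b c = a * c + c * b - (2 * qre b) *\<^sub>R c"

text \<open>If the real parts differ, the vanishing of the imaginary part of the discriminant makes \<open>a\<close>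
  real, and its real part is then \<open>(a - Re b)\<^sup>2\<close> plus the squared norm of the imaginary part of \<open>b\<close>.\<close>

lemma sylvester_disc_eq_0_iff:
  "sylvester_disc a b = 0 \<longleftrightarrow> qre a = qre b \<and> (norm a)\<^sup>2 = (norm b)\<^sup>2"
proof
  assume "sylvester_disc a b = 0"
  hence eq: "2 * (qre a - qre b) * qre a + ((norm b)\<^sup>2 - (norm a)\<^sup>2) = 0"
    "(qre a - qre b) * qi a = 0" "(qre a - qre b) * qj a = 0" "(qre a - qre b) * qk a = 0"
    by (simp_all add: sylvester_disc_def quat_eq_iff quat_sel_times)
  have "qre a = qre b"
  proof (rule ccontr)
    assume ne: "qre a \<noteq> qre b"
    hence "qi a = 0" "qj a = 0" "qk a = 0" using eq by auto
    hence "(qre a - qre b)\<^sup>2 + ((qi b)\<^sup>2 + (qj b)\<^sup>2 + (qk b)\<^sup>2) = 0"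
      using eq(1) unfolding norm_quat_squared
      by (simp add: power2_eq_square algebra_simps)
    moreover have "(qre a - qre b)\<^sup>2 > 0" using ne by simp
    moreover have "(qi b)\<^sup>2 + (qj b)\<^sup>2 + (qk b)\<^sup>2 \<ge> 0" by simp
    ultimately show False by linarith
  qed
  thus "qre a = qre b \<and> (norm a)\<^sup>2 = (norm b)\<^sup>2" using eq(1) by simp
qed (simp add: sylvester_disc_def)

lemma quat_square: "b * b = (2 * qre b) *\<^sub>R b - (norm b)\<^sup>2 *\<^sub>R 1"
  unfolding norm_quat_squared
  by (simp add: quat_eq_iff quat_sel_times power2_eq_square algebra_simps)

text \<open>Both \<open>a\<close> and \<open>b\<close> satisfy their real quadratic equations.  The polynomial of \<open>b\<close>, evaluated at
  the commuting operators \<open>L\<close> of left multiplication by \<open>a\<close> and \<open>M\<close> of right multiplication by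
  \<open>b\<close>, gives multiplication by the discriminant and zero, respectively, and \<open>L - M\<close> divides the
  difference of these values.\<close>

lemma sylvester_factor:
  "a * sylvester_cofactor a b c - sylvester_cofactor a b c * b = sylvester_disc a b * c" (is ?A)
  "sylvester_cofactor a b (a * c - c * b) = sylvester_disc a b * c" (is ?B)
proof -
  define \<alpha> \<beta> n m where def: "\<alpha> = 2 * qre a" "\<beta> = 2 * qre b" "n = (norm a)\<^sup>2" "m = (norm b)\<^sup>2"
  have "a * a = \<alpha> *\<^sub>R a - n *\<^sub>R 1" and bb: "b * b = \<beta> *\<^sub>R b - m *\<^sub>R 1"
    unfolding def by (rule quat_square)+
  hence aa: "a * (a * c) = \<alpha> *\<^sub>R (a * c) - n *\<^sub>R c" for c
    by (simp add: left_diff_distrib flip: mult.assoc)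
  have cof: "sylvester_cofactor a b c = a * c + c * b - \<beta> *\<^sub>R c" for c
    by (simp add: sylvester_cofactor_def def)
  have disc: "sylvester_disc a b * c = (\<alpha> - \<beta>) *\<^sub>R (a * c) + (m - n) *\<^sub>R c"
    by (simp add: sylvester_disc_def def algebra_simps)
  show ?A ?B
    unfolding disc cof by (simp_all add: algebra_simps aa bb)
qed

context slice_domain_at
begin

context
  fixes f g :: sem and \<phi> \<psi> :: "real \<Rightarrow> quat"
  assumes f: "has_germ f \<phi>" and g: "has_germ g \<psi>"
begin

lemma has_germ_sylvester:
  "has_germ X \<theta> \<Longrightarrow> has_germ (sylvester_minus \<Omega> f g X) (\<lambda>x. \<phi> x * \<theta> x - \<theta> x * \<psi> x)"
  unfolding sylvester_minus_def by (intro has_germ_minus has_germ_mult f g)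

lemma sylvester_real_linear:
  assumes a: "a \<in> SEM\<^sub>R \<Omega>" and X: "X \<in> carrier R"
  shows "sylvester_minus \<Omega> f g (a \<otimes>\<^bsub>R\<^esub> X) = a \<otimes>\<^bsub>R\<^esub> sylvester_minus \<Omega> f g X"
proof -
  obtain t where t: "has_germ a (\<lambda>x. of_real (t x))" using SEM\<^sub>R_germ[OF a] .
  obtain \<theta> where \<theta>: "has_germ X \<theta>" using has_germ_exists[OF X] .
  show ?thesis
    by (rule has_germ_eqI[OF has_germ_sylvester[OF has_germ_mult[OF t \<theta>]]
          has_germ_mult[OF t has_germ_sylvester[OF \<theta>]]])
      (simp flip: scaleR_conv_of_real add: scaleR_diff_right)
qed

lemma sylvester_cofactor_element:
  assumes "has_germ X \<theta>"
  obtains Y where "has_germ Y (\<lambda>x. sylvester_cofactor (\<phi> x) (\<psi> x) (\<theta> x))"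
proof -
  obtain B where B: "has_germ B (\<lambda>x. of_real (inner (2 *\<^sub>R 1) (\<psi> x)))"
    using coordinate_exists[OF g] .
  have "inner (2 *\<^sub>R 1) q = 2 * qre q" for q
    by (simp add: inner_quat_def)
  moreover have "has_germ (f \<otimes>\<^bsub>R\<^esub> X \<oplus>\<^bsub>R\<^esub> X \<otimes>\<^bsub>R\<^esub> g \<ominus>\<^bsub>R\<^esub> B \<otimes>\<^bsub>R\<^esub> X)
      (\<lambda>x. \<phi> x * \<theta> x + \<theta> x * \<psi> x - of_real (inner (2 *\<^sub>R 1) (\<psi> x)) * \<theta> x)"
    by (intro has_germ_minus has_germ_add has_germ_mult f g B assms)
  ultimately show ?thesis using that by (simp only: sylvester_cofactor_def scaleR_conv_of_real)
qed

lemma sylvester_disc_element: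
  obtains P where "has_germ P (\<lambda>x. sylvester_disc (\<phi> x) (\<psi> x))"
proof -
  obtain C where C: "has_germ C (\<lambda>x. sylvester_cofactor (\<phi> x) (\<psi> x) 1)"
    using sylvester_cofactor_element[OF has_germ_one] .
  from has_germ_sylvester[OF C] show ?thesis by (intro that) (simp add: sylvester_factor)
qed

text \<open>An invertible discriminant makes the operator invertible, because the discriminant is the
  product of the operator with its cofactor.\<close>

lemma sylvester_isomorphism:
  assumes "\<not> (\<forall>\<^sub>F x in at r. sylvester_disc (\<phi> x) (\<psi> x) = 0)"
  shows "sem_isomorphism \<Omega> (sylvester_minus \<Omega> f g)"
proof -
  let ?S = "sylvester_minus \<Omega> f g" and ?\<rho> = "\<lambda>x. sylvester_disc (\<phi> x) (\<psi> x)"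
  obtain P where P: "has_germ P ?\<rho>" using sylvester_disc_element .
  have "P \<noteq> \<zero>\<^bsub>R\<^esub>" using assms has_germ_eq_iff[OF P has_germ_zero] by blast
  hence nz: "\<forall>\<^sub>F x in at r. ?\<rho> x \<noteq> 0" by (rule nonzero_element[OF P])
  obtain Q where Q: "has_germ Q (\<lambda>x. inverse (?\<rho> x))" using has_germ_inverse[OF P] .
  have closed: "?S X \<in> carrier R" if "X \<in> carrier R" for X
    using has_germ_exists[OF that] has_germ_sylvester has_germ_carrier by metis
  have "?S (X \<oplus>\<^bsub>R\<^esub> Y) = ?S X \<oplus>\<^bsub>R\<^esub> ?S Y" if XY: "X \<in> carrier R" "Y \<in> carrier R" for X Y
  proof -
    obtain \<theta> where \<theta>: "has_germ X \<theta>" using has_germ_exists[OF XY(1)] .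
    obtain \<eta> where \<eta>: "has_germ Y \<eta>" using has_germ_exists[OF XY(2)] .
    show ?thesis
      by (rule has_germ_eqI[OF has_germ_sylvester[OF has_germ_add[OF \<theta> \<eta>]]
            has_germ_add[OF has_germ_sylvester[OF \<theta>] has_germ_sylvester[OF \<eta>]]])
        (simp add: algebra_simps)
  qed
  hence hom: "?S \<in> hom (add_monoid R) (add_monoid R)"
    using closed by (auto simp: hom_def)
  have inj: "inj_on ?S (carrier R)"
  proof (rule inj_onI)
    fix X Y assume XY: "X \<in> carrier R" "Y \<in> carrier R" "?S X = ?S Y"
    obtain \<theta> where \<theta>: "has_germ X \<theta>" using has_germ_exists[OF XY(1)] .
    obtain \<eta> where \<eta>: "has_germ Y \<eta>" using has_germ_exists[OF XY(2)] .
    have "\<forall>\<^sub>F x in at r. \<phi> x * \<theta> x - \<theta> x * \<psi> x = \<phi> x * \<eta> x - \<eta> x * \<psi> x"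
      using XY(3) has_germ_eq_iff[OF has_germ_sylvester[OF \<theta>] has_germ_sylvester[OF \<eta>]] by blast
    hence "\<forall>\<^sub>F x in at r. \<theta> x = \<eta> x"
      using nz
    proof eventually_elim
      case (elim x)
      have "?\<rho> x * \<theta> x = ?\<rho> x * \<eta> x" unfolding sylvester_factor(2)[symmetric] by (simp only: elim(1))
      thus ?case using elim(2) by simp
    qed
    thus "X = Y" using has_germ_eq_iff[OF \<theta> \<eta>] by blast
  qed
  have surj: "\<exists>X\<in>carrier R. ?S X = Y" if Y: "Y \<in> carrier R" for Y
  proof -
    obtain \<eta> where \<eta>: "has_germ Y \<eta>" using has_germ_exists[OF Y] .
    \<comment> \<open>As operator times cofactor is \<open>\<rho>\<close>, the cofactor of \<open>Y\<close> divided by \<open>\<rho>\<close> is a preimage of \<open>Y\<close>.\<close>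
    obtain X where X: "has_germ X (\<lambda>x. sylvester_cofactor (\<phi> x) (\<psi> x) (inverse (?\<rho> x) * \<eta> x))"
      using sylvester_cofactor_element[OF has_germ_mult[OF Q \<eta>]] .
    have "\<forall>\<^sub>F x in at r. ?\<rho> x * (inverse (?\<rho> x) * \<eta> x) = \<eta> x"
      using nz by eventually_elim (simp flip: mult.assoc)
    hence "?S X = Y"
      using has_germ_eq_iff[OF has_germ_sylvester[OF X] \<eta>] by (simp add: sylvester_factor(1))
    thus ?thesis using has_germ_carrier[OF X] by blast
  qed
  have "?S ` carrier R = carrier R" using closed surj by (auto simp: image_iff)
  hence "bij_betw ?S (carrier R) (carrier R)" using inj by (simp add: bij_betw_def)
  thus ?thesis
    unfolding sem_isomorphism_def iso_def using hom sylvester_real_linear by simp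
qed

text \<open>If the discriminant vanishes then the operator annihilates every value of the cofactor.
  If the cofactor itself is zero at \<open>1\<close>, \<open>i\<close> and \<open>j\<close>, then \<open>f\<close> is the conjugate of \<open>g\<close> and \<open>g\<close>
  commutes with \<open>i\<close> and \<open>j\<close>; hence \<open>f = g\<close>, both real, and the operator annihilates \<open>1\<close>.\<close>

lemma sylvester_kernel:
  assumes disc: "\<forall>\<^sub>F x in at r. sylvester_disc (\<phi> x) (\<psi> x) = 0"
  obtains h where "h \<in> Units R" "f \<otimes>\<^bsub>R\<^esub> h = h \<otimes>\<^bsub>R\<^esub> g"
proof (cases "\<exists>c C. has_germ C (\<lambda>x. sylvester_cofactor (\<phi> x) (\<psi> x) c) \<and> C \<noteq> \<zero>\<^bsub>R\<^esub>")
  case True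
  then obtain c C where C: "has_germ C (\<lambda>x. sylvester_cofactor (\<phi> x) (\<psi> x) c)" "C \<noteq> \<zero>\<^bsub>R\<^esub>"
    by blast
  have "\<forall>\<^sub>F x in at r. \<phi> x * sylvester_cofactor (\<phi> x) (\<psi> x) c = sylvester_cofactor (\<phi> x) (\<psi> x) c * \<psi> x"
    using disc
  proof eventually_elim
    case (elim x)
    thus ?case using sylvester_factor(1)[of "\<phi> x" "\<psi> x" c] by simp
  qed
  hence "f \<otimes>\<^bsub>R\<^esub> C = C \<otimes>\<^bsub>R\<^esub> g"
    using has_germ_eq_iff[OF has_germ_mult[OF f C(1)] has_germ_mult[OF C(1) g]] by blast
  thus ?thesis using that nonzero_unit[OF has_germ_carrier[OF C(1)] C(2)] by blast
next
  case False
  have zero: "\<forall>\<^sub>F x in at r. sylvester_cofactor (\<phi> x) (\<psi> x) c = 0" for c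
  proof -
    obtain C where C: "has_germ C (\<lambda>x. sylvester_cofactor (\<phi> x) (\<psi> x) c)"
      using sylvester_cofactor_element[OF has_germ_const] .
    thus ?thesis using False has_germ_eq_iff[OF C has_germ_zero] by blast
  qed
  have "\<forall>\<^sub>F x in at r. \<phi> x = \<psi> x"
    using zero[of 1] zero[of "Quat 0 1 0 0"] zero[of "Quat 0 0 1 0"]
    by eventually_elim (simp add: sylvester_cofactor_def quat_eq_iff quat_sel_times)
  hence "f = g" using has_germ_eq_iff[OF f g] by blast
  moreover have "g \<in> carrier R" using g by (rule has_germ_carrier)
  ultimately show ?thesis using that[OF Units_one_closed] by simp
qed

text \<open>Conjugation of a quaternion preserves its real part and its norm.\<close>

lemma similar_imp_disc:
  assumes "similar \<Omega> f g"
  shows "\<forall>\<^sub>F x in at r. sylvester_disc (\<phi> x) (\<psi> x) = 0"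
proof -
  obtain h where h: "h \<in> Units R" "f = inv\<^bsub>R\<^esub> h \<otimes>\<^bsub>R\<^esub> g \<otimes>\<^bsub>R\<^esub> h"
    using assms by (auto simp: similar_def)
  obtain \<eta> where \<eta>: "has_germ h \<eta>" using has_germ_exists Units_closed[OF h(1)] by blast
  obtain \<zeta> where \<zeta>: "has_germ (inv\<^bsub>R\<^esub> h) \<zeta>"
    using has_germ_exists Units_inv_closed[OF h(1)] by blast
  have "\<forall>\<^sub>F x in at r. \<zeta> x * \<eta> x = 1"
    using Units_l_inv[OF h(1)] has_germ_eq_iff[OF has_germ_mult[OF \<zeta> \<eta>] has_germ_one] by blast
  moreover have "\<forall>\<^sub>F x in at r. \<phi> x = \<zeta> x * \<psi> x * \<eta> x"
    using h(2) has_germ_eq_iff[OF f has_germ_mult[OF has_germ_mult[OF \<zeta> g] \<eta>]] by blast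
  ultimately show ?thesis
  proof eventually_elim
    case (elim x)
    have "\<zeta> x \<noteq> 0" using elim(1) by auto
    moreover have "\<eta> x = inverse (\<zeta> x)" using inverse_unique[OF elim(1)] by simp
    ultimately have inv: "\<eta> x * \<zeta> x = 1" by simp
    have "qre (\<phi> x) = qre (\<eta> x * (\<zeta> x * \<psi> x))" unfolding elim(2) by (rule qre_mult_commute)
    also have "\<dots> = qre (\<psi> x)" using inv by (simp flip: mult.assoc)
    finally have "qre (\<phi> x) = qre (\<psi> x)" .
    moreover have "norm (\<phi> x) = norm (\<zeta> x * \<eta> x) * norm (\<psi> x)"
      unfolding elim(2) by (simp add: norm_mult)
    hence "norm (\<phi> x) = norm (\<psi> x)" by (simp add: elim(1))
    ultimately show ?case by (simp add: sylvester_disc_eq_0_iff)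
  qed
qed

lemma disc_imp_similar:
  assumes "\<forall>\<^sub>F x in at r. sylvester_disc (\<phi> x) (\<psi> x) = 0"
  shows "similar \<Omega> f g"
proof -
  obtain h where h: "h \<in> Units R" "f \<otimes>\<^bsub>R\<^esub> h = h \<otimes>\<^bsub>R\<^esub> g" using sylvester_kernel[OF assms] .
  have fg: "f \<in> carrier R" "g \<in> carrier R" using f g has_germ_carrier by blast+
  have "f = f \<otimes>\<^bsub>R\<^esub> h \<otimes>\<^bsub>R\<^esub> inv\<^bsub>R\<^esub> h"
    using h(1) fg Units_closed[OF h(1)] by (simp add: m_assoc)
  also have "\<dots> = inv\<^bsub>R\<^esub> (inv\<^bsub>R\<^esub> h) \<otimes>\<^bsub>R\<^esub> g \<otimes>\<^bsub>R\<^esub> inv\<^bsub>R\<^esub> h"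
    using h by simp
  finally show ?thesis unfolding similar_def using Units_inv_Units[OF h(1)] by blast
qed

lemma disc_imp_not_isomorphism:
  assumes "\<forall>\<^sub>F x in at r. sylvester_disc (\<phi> x) (\<psi> x) = 0"
  shows "\<not> sem_isomorphism \<Omega> (sylvester_minus \<Omega> f g)"
proof
  assume "sem_isomorphism \<Omega> (sylvester_minus \<Omega> f g)"
  hence inj: "inj_on (sylvester_minus \<Omega> f g) (carrier R)"
    by (auto simp: sem_isomorphism_def iso_def bij_betw_def)
  obtain h where h: "h \<in> Units R" "f \<otimes>\<^bsub>R\<^esub> h = h \<otimes>\<^bsub>R\<^esub> g" using sylvester_kernel[OF assms] .
  have fg: "f \<in> carrier R" "g \<in> carrier R" using f g has_germ_carrier by blast+
  have "sylvester_minus \<Omega> f g h = \<zero>\<^bsub>R\<^esub>" "sylvester_minus \<Omega> f g \<zero>\<^bsub>R\<^esub> = \<zero>\<^bsub>R\<^esub>"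
    using h fg Units_closed[OF h(1)] by (simp_all add: sylvester_minus_def a_minus_def r_neg)
  hence "h = \<zero>\<^bsub>R\<^esub>" using inj h(1) by (metis inj_onD Units_closed zero_closed)
  moreover have "\<one>\<^bsub>R\<^esub> \<noteq> \<zero>\<^bsub>R\<^esub>"
    by (simp add: has_germ_eq_iff[OF has_germ_one has_germ_zero])
  ultimately show False using h(1) Units_l_inv[OF h(1)] by simp
qed

end

end

theorem proposition1p1:
  fixes \<Omega> :: "quat set" and f g :: sem and I J K :: quat
  assumes "slice_domain \<Omega>"
    and "orthonormal_basis I J K"
    and "f \<in> carrier (SEM \<Omega>)" and "g \<in> carrier (SEM \<Omega>)"
  shows "(similar \<Omega> f g \<longleftrightarrow>
           real_part \<Omega> (I, J, K) f = real_part \<Omega> (I, J, K) g \<and>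
           symmetrization \<Omega> (I, J, K) f = symmetrization \<Omega> (I, J, K) g) \<and>
         (real_part \<Omega> (I, J, K) f = real_part \<Omega> (I, J, K) g \<and>
           symmetrization \<Omega> (I, J, K) f = symmetrization \<Omega> (I, J, K) g \<longleftrightarrow>
          \<not> sem_isomorphism \<Omega> (sylvester_minus \<Omega> f g))"
proof -
  obtain r where "of_real r \<in> \<Omega>"
    using assms(1) by (auto simp: slice_domain_def Reals_def)
  then interpret slice_domain_at \<Omega> r
    using assms(1) by unfold_locales
  obtain \<phi> where \<phi>: "has_germ f \<phi>" using has_germ_exists[OF assms(3)] .
  obtain \<psi> where \<psi>: "has_germ g \<psi>" using has_germ_exists[OF assms(4)] .
  have "real_part \<Omega> (I, J, K) f = real_part \<Omega> (I, J, K) g \<and>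
      symmetrization \<Omega> (I, J, K) f = symmetrization \<Omega> (I, J, K) g \<longleftrightarrow>
      (\<forall>\<^sub>F x in at r. sylvester_disc (\<phi> x) (\<psi> x) = 0)"
    unfolding has_germ_eq_iff[OF has_germ_real_part[OF assms(2) \<phi>] has_germ_real_part[OF assms(2) \<psi>]]
      has_germ_eq_iff[OF has_germ_symmetrization[OF assms(2) \<phi>] has_germ_symmetrization[OF assms(2) \<psi>]]
    by (simp add: sylvester_disc_eq_0_iff eventually_conj_iff)
  thus ?thesis
    using similar_imp_disc[OF \<phi> \<psi>] disc_imp_similar[OF \<phi> \<psi>]
      disc_imp_not_isomorphism[OF \<phi> \<psi>] sylvester_isomorphism[OF \<phi> \<psi>] by blast
qed

end
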